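(* Let $k \ge 2$ be a fixed integer, and let $\delta = 0$ if $k$ is odd and $\delta = 1$ if $k$ is even. Then, as $s \to \infty$, \[ R_\Delta(C_{2k}, s) = \Omega\left(\left(\frac{s}{\log s}\right)^{1+\frac{2}{3k-5+\delta}}\right). \] That is, there are a constant $c_k > 0$ and an integer $s_k$, depending only on $k$, such that for all integers $s \ge s_k$, $R_\Delta(C_{2k}, s) \ge c_k \left(\frac{s}{\log s}\right)^{1+\frac{2}{3k-5+\delta}}$.
   Context: All graphs are finite and simple. $C_m$ is the cycle on $m$ vertices and $\Delta(H)$ is the maximum degree of $H$. For graphs $H, G$ and a positive integer $s$, write $H \xrightarrow{s} G$ if every coloring of the edges of $H$ with $s$ colors (an arbitrary map from $E(H)$ to a set of $s$ colors) contains a monochromatic subgraph isomorphic to $G$. The degree Ramsey number of $G$ is $R_\Delta(G,s) = \min\{\Delta(H) : H \xrightarrow{s} G\}$. *)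

theory Defs
  imports Complex_Main
begin

record 'a ugraph =
  gverts :: "'a set"
  gedges :: "'a set set"

definition simple_graph :: "'a ugraph \<Rightarrow> bool" where
  "simple_graph G \<longleftrightarrow> finite (gverts G) \<and> (\<forall>e \<in> gedges G. e \<subseteq> gverts G \<and> card e = 2)"

definition vertex_degree :: "'a ugraph \<Rightarrow> 'a \<Rightarrow> nat" where
  "vertex_degree G v = card {e \<in> gedges G. v \<in> e}"

(* The inserted 0 only matters for the graph without vertices. *)
definition max_degree :: "'a ugraph \<Rightarrow> nat" where
  "max_degree G = Max (insert 0 (vertex_degree G ` gverts G))"

definition is_subgraph :: "'a ugraph \<Rightarrow> 'a ugraph \<Rightarrow> bool" where
  "is_subgraph F H \<longleftrightarrow>
     simple_graph F \<and> gverts F \<subseteq> gverts H \<and> gedges F \<subseteq> gedges H"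

definition isomorphic_graphs :: "'a ugraph \<Rightarrow> 'b ugraph \<Rightarrow> bool" where
  "isomorphic_graphs F G \<longleftrightarrow>
     (\<exists>f. bij_betw f (gverts F) (gverts G) \<and>
          (\<forall>u \<in> gverts F. \<forall>v \<in> gverts F. {u, v} \<in> gedges F \<longleftrightarrow> {f u, f v} \<in> gedges G))"

(* A genuine cycle only for m >= 3. *)
definition cycle_graph :: "nat \<Rightarrow> nat ugraph" where
  "cycle_graph m =
     \<lparr>gverts = {..<m}, gedges = {{i, (i + 1) mod m} | i. i < m}\<rparr>"

(* Colorings are total functions; only their values on the edges of H matter. *)
definition ramsey_arrow :: "'a ugraph \<Rightarrow> nat \<Rightarrow> 'b ugraph \<Rightarrow> bool" where
  "ramsey_arrow H s G \<longleftrightarrow>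
     (\<forall>c :: 'a set \<Rightarrow> nat. c ` gedges H \<subseteq> {..<s} \<longrightarrow>
        (\<exists>F. is_subgraph F H \<and> isomorphic_graphs F G \<and>
             (\<exists>i. \<forall>e \<in> gedges F. c e = i)))"

(* Every finite graph has an isomorphic copy with vertices in nat, so the minimum is over
   all finite simple graphs H. On nonempty sets of natural numbers, Inf is the minimum; the set
   is nonempty for every finite simple G by Ramsey's theorem. *)
definition degree_ramsey :: "'b ugraph \<Rightarrow> nat \<Rightarrow> nat" where
  "degree_ramsey G s =
     Inf {max_degree H | H :: nat ugraph. simple_graph H \<and> ramsey_arrow H s G}"

end

theory Submission
  imports Defs "HOL-Algebra.Algebraic_Closure_Type" "HOL-Library.Z2" "HOL-Library.Ramsey"
begin

text \<open>
  Let $q = 2^m$ and $e = k + \lfloor k/2 \rfloor$, and let $U$ be the group of matrices of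
  determinant 1 over $F_q[[z]]$ that are upper unitriangular modulo $z$, truncated so that
  $|U| = q^e$. Let $A$ and $B$ be its subgroups of order $q$ whose elements differ from 1 only in an
  entry $s$ at position $(1,2)$ and in an entry $tz$ at position $(2,1)$, respectively. Colouring a
  pair of cosets $(Ag, Bh)$ by the double coset of $g h^{-1}$ uses $q^{e-2}$ colours on $q^{e-1}$
  points and $q^{e-1}$ lines, and no colour contains a closed nonbacktracking walk of length $2k$:
  cut at two opposite edges, such a walk equates two alternating words of length $k$ in $A$ and a
  conjugate of $B$, one with leftmost letter in $A$ and the other with leftmost letter in the
  conjugate of $B$, and these differ in a coefficient of degree $k$, which survives the truncation.

  A bipartite graph of maximum degree at most $q^{e-1}$ is labelled by the local lemma with points
  and lines such that every label occurs $O(\log q)$ times around every vertex. Splitting each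
  colour $O(\log q)$ times makes the labelling locally injective, so a monochromatic $C_{2k}$ would
  be mapped to a closed nonbacktracking walk. A general graph is reduced to bipartite ones by maximum
  cuts: the edges that are not cut have at most half of the maximum degree, so the numbers of colours
  sum up geometrically.
\<close>

subsection \<open>The local lemma and frugal labellings\<close>

text \<open>The symmetric local lemma, with counting in a finite set of outcomes in place of
  probabilities. Independence enters only as the bound p for \<open>A i\<close> conditioned on
  avoiding any events outside \<open>D i\<close>.\<close>

lemma local_lemma_counting:
  fixes \<Omega> :: "'b set" and A :: "'i \<Rightarrow> 'b set" and p :: real and d :: nat
  assumes "finite I" and fin: "finite \<Omega>" and ne: "\<Omega> \<noteq> {}"
    and sub: "\<And>i. i \<in> I \<Longrightarrow> A i \<subseteq> \<Omega>"
    and d: "\<And>i. i \<in> I \<Longrightarrow> card (D i \<inter> I) \<le> d"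
    and indep: "\<And>i S. i \<in> I \<Longrightarrow> S \<subseteq> I \<Longrightarrow> S \<inter> D i = {} \<Longrightarrow>
      real (card (A i \<inter> (\<Omega> - \<Union>(A ` S)))) \<le> p * card (\<Omega> - \<Union>(A ` S))"
    and p: "0 \<le> p" "2 * p < 1" "4 * p * d \<le> 1"
  shows "\<exists>\<omega>\<in>\<Omega>. \<forall>i\<in>I. \<omega> \<notin> A i"
proof -
  define N where "N S = \<Omega> - \<Union>(A ` S)" for S
  have finN: "finite (N S)" for S using fin by (simp add: N_def)
  \<comment> \<open>Conditioned on avoiding \<open>S\<close>, the event \<open>A i\<close> has
    probability at most 2p. The induction is on the size of \<open>S\<close>, which is split into
    the events near i (\<open>S1\<close>) and the others (\<open>S2\<close>).\<close>
  have key: "real (card (A i \<inter> N S)) \<le> 2 * p * card (N S)" if "i \<in> I" "S \<subseteq> I" for i S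
    using that
  proof (induction "card S" arbitrary: i S rule: less_induct)
    case less
    have finS: "finite S" using less.prems \<open>finite I\<close> finite_subset by blast
    define S1 where "S1 = S \<inter> D i"
    define S2 where "S2 = S - D i"
    have S: "S = S2 \<union> S1" by (auto simp: S1_def S2_def)
    have ind: "real (card (A i \<inter> N S2)) \<le> p * card (N S2)"
      unfolding N_def using less.prems by (intro indep) (auto simp: S2_def)
    have le: "card (A i \<inter> N S) \<le> card (A i \<inter> N S2)"
      using fin by (intro card_mono) (auto simp: S N_def)
    show ?case
    proof (cases "S1 = {}")
      case True
      then have "N S = N S2" using S by simp
      moreover have "p * card (N S2) \<le> 2 * p * card (N S2)" using p by simp
      ultimately show ?thesis using ind by (simp only:)
    next
      case False
      then have "card S2 < card S"
        using finS by (intro psubset_card_mono) (auto simp: S1_def S2_def)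
      then have IH: "real (card (A j \<inter> N S2)) \<le> 2 * p * card (N S2)" if "j \<in> S1" for j
        using less.hyps[of S2 j] that less.prems by (auto simp: S1_def S2_def)
      have "card S1 \<le> card (D i \<inter> I)"
        using less.prems \<open>finite I\<close> by (intro card_mono) (auto simp: S1_def)
      then have cS1: "card S1 \<le> d" using d[OF less.prems(1)] by simp
      have finS1: "finite S1" using finS S by simp
      \<comment> \<open>Given that \<open>S2\<close> is avoided, the at most d near events have
        total probability at most 2pd, hence at most 1/2. Avoiding them too keeps at least half of
        \<open>N S2\<close> and so at most doubles the bound p.\<close>
      have "N S2 = N S \<union> (\<Union>j\<in>S1. A j \<inter> N S2)" by (auto simp: N_def S)
      then have "card (N S2) \<le> card (N S) + card (\<Union>j\<in>S1. A j \<inter> N S2)"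
        by (metis card_Un_le)
      also have "card (\<Union>j\<in>S1. A j \<inter> N S2) \<le> (\<Sum>j\<in>S1. card (A j \<inter> N S2))"
        by (rule card_UN_le[OF finS1])
      finally have "real (card (N S2)) \<le> card (N S) + (\<Sum>j\<in>S1. real (card (A j \<inter> N S2)))"
        by (simp flip: of_nat_sum of_nat_add)
      also have "(\<Sum>j\<in>S1. real (card (A j \<inter> N S2))) \<le> (\<Sum>j\<in>S1. 2 * p * card (N S2))"
        by (intro sum_mono IH)
      also have "\<dots> = card S1 * (2 * p * card (N S2))" by simp
      also have "\<dots> \<le> d * (2 * p * card (N S2))"
        using cS1 p by (intro mult_right_mono) auto
      also have "\<dots> = (4 * p * d) * (card (N S2) / 2)" by simp
      also have "\<dots> \<le> 1 * (card (N S2) / 2)" using p by (intro mult_right_mono) auto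
      finally have "real (card (N S2)) \<le> 2 * card (N S)" by simp
      then have "p * card (N S2) \<le> p * (2 * card (N S))" using p by (intro mult_left_mono) auto
      then show ?thesis using ind le by linarith
    qed
  qed
  \<comment> \<open>The events are added one at a time, and each removes at most the fraction 2p < 1
    of what is left.\<close>
  have "N S \<noteq> {}" if "S \<subseteq> I" for S
    using finite_subset[OF that \<open>finite I\<close>] that
  proof (induction S rule: finite_induct)
    case empty
    then show ?case using ne by (simp add: N_def)
  next
    case (insert i S)
    then have c: "card (N S) > 0" using finN by (simp add: card_gt_0_iff)
    have "2 * p * card (N S) < card (N S)" using c p by simp
    then have "card (A i \<inter> N S) < card (N S)" using key[of i S] insert.prems by simp
    moreover have "card (N S) \<le> card (A i \<inter> N S) + card (N (insert i S))"
      by (rule order_trans[OF card_mono card_Un_le]) (auto simp: finN N_def fin)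
    ultimately have "card (N (insert i S)) > 0" by linarith
    then show ?case by force
  qed
  from this[of I] show ?thesis by (auto simp: N_def)
qed

text \<open>For a uniformly random labelling with N labels, some label occurs L times around u with
  probability at most N * (N choose L) / N^L, which is at most N / L!. The events at u and u'
  interact only if u and u' have a common neighbour. This leaves at most N^2 events near u, and the
  local lemma asks for 4 N^3 <= L!.\<close>

lemma frugal_labelling:
  fixes V :: "'a set" and N L :: nat and Nb :: "'a \<Rightarrow> 'a set"
  assumes fin: "finite V" and Nb: "\<And>u. Nb u \<subseteq> V" and sym: "\<And>u w. w \<in> Nb u \<longleftrightarrow> u \<in> Nb w"
    and deg: "\<And>u. card (Nb u) \<le> N" and N: "N \<ge> 1" and L: "4 * N ^ 3 \<le> fact L"
  obtains f :: "'a \<Rightarrow> nat" where "\<And>u. u \<in> V \<Longrightarrow> f u < N"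
    "\<And>u c. u \<in> V \<Longrightarrow> card {w \<in> Nb u. f w = c} < L"
proof -
  define \<Omega> where "\<Omega> = (V \<rightarrow>\<^sub>E {..<N})"
  define A where "A u = {f \<in> \<Omega>. \<exists>c. L \<le> card {w \<in> Nb u. f w = c}}" for u
  define D where "D u = {u'. Nb u \<inter> Nb u' \<noteq> {}}" for u
  define p where "p = real N / fact L"
  have finNb: "finite (Nb u)" for u using Nb fin finite_subset by blast
  have fin\<Omega>: "finite \<Omega>" unfolding \<Omega>_def using fin by (intro finite_PiE) auto
  have ne: "\<Omega> \<noteq> {}" unfolding \<Omega>_def using N by (auto simp: PiE_eq_empty_iff lessThan_empty_iff)
  have Lr: "4 * real N ^ 3 \<le> fact L"
    using of_nat_mono[OF L, where 'a = real] by simp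
  have L1: "L \<ge> 1"
  proof (rule ccontr)
    assume "\<not> L \<ge> 1"
    then have "L = 0" by simp
    then have "4 * N ^ 3 \<le> 1" using L by simp
    moreover have "1 \<le> N ^ 3" using N by simp
    ultimately show False by linarith
  qed
  have dD: "card (D u \<inter> V) \<le> N ^ 2" for u
  proof -
    have "D u \<inter> V \<subseteq> (\<Union>w\<in>Nb u. Nb w)" using sym by (auto simp: D_def)
    then have "card (D u \<inter> V) \<le> card (\<Union>w\<in>Nb u. Nb w)" by (intro card_mono) (auto simp: finNb)
    also have "\<dots> \<le> (\<Sum>w\<in>Nb u. card (Nb w))" by (rule card_UN_le[OF finNb])
    also have "\<dots> \<le> (\<Sum>w\<in>Nb u. N)" by (intro sum_mono deg)
    also have "\<dots> \<le> N * N" using deg by simp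
    finally show ?thesis by (simp add: power2_eq_square)
  qed
  have indep: "real (card (A u \<inter> (\<Omega> - \<Union>(A ` S)))) \<le> p * card (\<Omega> - \<Union>(A ` S))"
    if u: "u \<in> V" and S: "S \<subseteq> V" "S \<inter> D u = {}" for u S
  proof -
    define M where "M = \<Omega> - \<Union>(A ` S)"
    have finM: "finite M" using fin\<Omega> by (simp add: M_def)
    \<comment> \<open>A bad labelling is constant on some L neighbours of u, so the event is covered
      by one case for each such set and each label.\<close>
    define Ws where "Ws = {W. W \<subseteq> Nb u \<and> card W = L} \<times> {..<N}"
    have finWs: "finite Ws" unfolding Ws_def using finNb by auto
    define Z where "Z = (\<lambda>(W, c). {f \<in> M. \<forall>w\<in>W. f w = c})"
    have "A u \<inter> M \<subseteq> (\<Union>y\<in>Ws. Z y)"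
    proof
      fix f assume f: "f \<in> A u \<inter> M"
      then obtain c where c: "L \<le> card {w \<in> Nb u. f w = c}" by (auto simp: A_def)
      then obtain W where W: "W \<subseteq> {w \<in> Nb u. f w = c}" "card W = L"
        by (meson obtain_subset_with_card_n)
      then obtain w where "w \<in> W" using L1 by fastforce
      then have "f w = c" "w \<in> V" using W Nb by auto
      then have "c < N" using f by (auto simp: M_def \<Omega>_def)
      then show "f \<in> (\<Union>y\<in>Ws. Z y)"
        using W f by (intro UN_I[of "(W, c)"]) (auto simp: Ws_def Z_def)
    qed
    then have "card (A u \<inter> M) \<le> card (\<Union>y\<in>Ws. Z y)"
      by (intro card_mono) (auto simp: finWs Z_def finM)
    also have "\<dots> \<le> (\<Sum>y\<in>Ws. card (Z y))" by (rule card_UN_le[OF finWs])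
    finally have 1: "card (A u \<inter> M) \<le> (\<Sum>y\<in>Ws. card (Z y))" .
    \<comment> \<open>No event in \<open>S\<close> depends on the labels on \<open>W\<close>, so
      these can be replaced freely without leaving \<open>M\<close>. Each labelling in
      \<open>Z y\<close> thus yields N^L labellings in \<open>M\<close>, and all of these are
      distinct.\<close>
    have 2: "card (Z y) * N ^ L \<le> card M" if y: "y \<in> Ws" for y
    proof -
      obtain W c where Wc: "y = (W, c)" "W \<subseteq> Nb u" "card W = L" "c < N" using y
          by (auto simp: Ws_def)
      define h :: "('a \<Rightarrow> nat) \<times> ('a \<Rightarrow> nat) \<Rightarrow> 'a \<Rightarrow> nat"
        where "h = (\<lambda>(f, g) v. if v \<in> W then g v else f v)"
      have finW: "finite W" using Wc finNb finite_subset by blast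
      have "inj_on h (Z y \<times> (W \<rightarrow>\<^sub>E {..<N}))"
      proof (rule inj_onI, clarify)
        fix f g f' g'
        assume a: "f \<in> Z y" "g \<in> W \<rightarrow>\<^sub>E {..<N}" "f' \<in> Z y" "g' \<in> W \<rightarrow>\<^sub>E {..<N}" "h (f, g)
            = h (f', g')"
        have e: "(if v \<in> W then g v else f v) = (if v \<in> W then g' v else f' v)" for v
          using fun_cong[OF a(5), of v] by (simp add: h_def)
        have "f v = f' v" for v using e[of v] a(1,3) Wc(1) by (cases "v \<in> W") (auto simp: Z_def)
        moreover have "g v = g' v" for v
          using e[of v] a(2,4) by (cases "v \<in> W") (auto simp: PiE_def extensional_def)
        ultimately show "f = f' \<and> g = g'" by blast
      qed
      moreover have "h ` (Z y \<times> (W \<rightarrow>\<^sub>E {..<N})) \<subseteq> M"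
      proof clarify
        fix f g assume f: "f \<in> Z y" and g: "g \<in> W \<rightarrow>\<^sub>E {..<N}"
        have fM: "f \<in> M" using f Wc by (auto simp: Z_def)
        have WV: "W \<subseteq> V" using Wc Nb by blast
        have \<Omega>: "h (f, g) \<in> \<Omega>"
          using fM g WV by (auto simp: M_def \<Omega>_def h_def PiE_iff extensional_def)
        have "h (f, g) \<notin> A u'" if "u' \<in> S" for u'
        proof -
          have "Nb u' \<inter> W = {}" using that S Wc by (auto simp: D_def)
          then have "{w \<in> Nb u'. h (f, g) w = c} = {w \<in> Nb u'. f w = c}" for c
            by (auto simp: h_def)
          moreover have "f \<notin> A u'" "f \<in> \<Omega>" using fM that by (auto simp: M_def)
          ultimately show ?thesis by (simp add: A_def)
        qed
        then show "h (f, g) \<in> M" using \<Omega> by (simp add: M_def)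
      qed
      ultimately have "card (Z y \<times> (W \<rightarrow>\<^sub>E {..<N})) \<le> card M"
        using finM by (intro card_inj_on_le[of h])
      then show ?thesis using finW Wc by (simp add: card_cartesian_product card_PiE)
    qed
    have cWs: "card Ws = (card (Nb u) choose L) * N"
      by (simp add: Ws_def card_cartesian_product n_subsets finNb)
    have "card Ws * fact L \<le> N ^ L * N"
    proof -
      have "(card (Nb u) choose L) * fact L \<le> card (Nb u) ^ L" by (rule binomial_fact_pow)
      also have "\<dots> \<le> N ^ L" by (rule power_mono[OF deg]) simp
      finally show ?thesis by (simp add: cWs algebra_simps)
    qed
    then have "card (A u \<inter> M) * N ^ L * fact L \<le> card M * (N ^ L * N)"
    proof -
      have "card (A u \<inter> M) * N ^ L \<le> (\<Sum>y\<in>Ws. card (Z y) * N ^ L)"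
        using mult_le_mono1[OF 1] by (simp add: sum_distrib_right)
      also have "\<dots> \<le> (\<Sum>y\<in>Ws. card M)" by (intro sum_mono 2)
      finally have "card (A u \<inter> M) * N ^ L \<le> card Ws * card M" by simp
      then have "card (A u \<inter> M) * N ^ L * fact L \<le> card Ws * card M * fact L" by simp
      also have "\<dots> = card M * (card Ws * fact L)" by simp
      also have "\<dots> \<le> card M * (N ^ L * N)" by (rule mult_le_mono2) fact
      finally show ?thesis .
    qed
    then have "(card (A u \<inter> M) * fact L) * N ^ L \<le> (card M * N) * N ^ L"
      by (simp add: algebra_simps)
    then have "card (A u \<inter> M) * fact L \<le> card M * N" using N by simp
    then have "real (card (A u \<inter> M)) * fact L \<le> real (card M) * N"
      using of_nat_mono[where 'a = real] by fastforce
    then show ?thesis by (simp add: p_def field_simps M_def)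
  qed
  have "\<exists>\<omega>\<in>\<Omega>. \<forall>u\<in>V. \<omega> \<notin> A u"
  proof (rule local_lemma_counting[where D = D and d = "N ^ 2" and p = p])
    show "0 \<le> p" by (simp add: p_def)
    have "real N \<le> real N ^ 3" using N by (simp add: self_le_power)
    then have "2 * real N < 4 * real N ^ 3" using N by linarith
    then have "2 * real N < fact L" using Lr by linarith
    then show "2 * p < 1" by (simp add: p_def)
    show "4 * p * real (N ^ 2) \<le> 1"
      using Lr by (simp add: p_def power2_eq_square power3_eq_cube mult.assoc)
  qed (use fin fin\<Omega> ne dD indep in \<open>auto simp: A_def\<close>)
  then obtain f where f: "f \<in> \<Omega>" "\<forall>u\<in>V. f \<notin> A u" by blast
  show ?thesis
  proof (rule that[of f])
    show "f u < N" if "u \<in> V" for u using f that by (auto simp: \<Omega>_def)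
    show "card {w \<in> Nb u. f w = c} < L" if "u \<in> V" for u c
      using f that by (auto simp: A_def not_le)
  qed
qed

lemma greedy_colouring:
  fixes R :: "'a \<Rightarrow> 'a \<Rightarrow> bool"
  assumes "finite Z" and sym: "\<And>x y. R x y \<Longrightarrow> R y x"
    and deg: "\<And>x. x \<in> Z \<Longrightarrow> card {y \<in> Z. R x y} < D"
  shows "\<exists>f :: 'a \<Rightarrow> nat. f ` Z \<subseteq> {..<D} \<and> (\<forall>x\<in>Z. \<forall>y\<in>Z. x \<noteq> y \<longrightarrow> R x y \<longrightarrow> f x \<noteq> f y)"
  using assms(1) deg
proof (induction Z rule: finite_induct)
  case empty
  then show ?case by simp
next
  case (insert x Z)
  have "card {y \<in> Z. R z y} < D" if "z \<in> Z" for z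
  proof -
    have "card {y \<in> Z. R z y} \<le> card {y \<in> insert x Z. R z y}"
      using insert.hyps by (intro card_mono) auto
    then show ?thesis using insert.prems[of z] that by simp
  qed
  from insert.IH[OF this] obtain f :: "'a \<Rightarrow> nat"
    where f: "f ` Z \<subseteq> {..<D}" "\<forall>y\<in>Z. \<forall>z\<in>Z. y \<noteq> z \<longrightarrow> R y z \<longrightarrow> f y \<noteq> f z"
    by auto
  have "card (f ` {y \<in> Z. R x y}) \<le> card {y \<in> Z. R x y}"
    using insert.hyps by (intro card_image_le) auto
  also have "\<dots> \<le> card {y \<in> insert x Z. R x y}" using insert.hyps by (intro card_mono) auto
  also have "\<dots> < card {..<D}" using insert.prems[of x] by simp
  finally have "\<not> {..<D} \<subseteq> f ` {y \<in> Z. R x y}"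
    using card_mono[of "f ` {y \<in> Z. R x y}" "{..<D}"] insert.hyps by auto
  then obtain c where c: "c < D" "c \<notin> f ` {y \<in> Z. R x y}" by auto
  have "(f(x := c)) ` insert x Z \<subseteq> {..<D}" using f(1) c(1) by auto
  moreover have "(f(x := c)) y \<noteq> (f(x := c)) z"
    if "y \<in> insert x Z" "z \<in> insert x Z" "y \<noteq> z" "R y z" for y z
    using that f(2) c(2) sym[of y z] insert.hyps by auto
  ultimately show ?case by blast
qed

subsection \<open>Finite fields of characteristic 2\<close>

text \<open>Fields of all orders 2^m are needed and a type cannot depend on m, so they are taken as
  subsets of one fixed field.\<close>

definition subfield_set :: "'a::field set \<Rightarrow> bool" where
  "subfield_set K \<longleftrightarrow> 0 \<in> K \<and> 1 \<in> K \<and> (\<forall>x\<in>K. \<forall>y\<in>K. x + y \<in> K \<and> x * y \<in> K) \<and>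
     (\<forall>x\<in>K. - x \<in> K \<and> inverse x \<in> K)"

lemma two_eq_0_bit_closure: "(2 :: bit alg_closure) = 0"
  using to_ac_numeral[where 'a = bit, of "num.Bit0 num.One"] by simp

lemma uminus_bit_closure: "- x = (x :: bit alg_closure)"
  using two_eq_0_bit_closure by (metis add_eq_0_iff mult_2 mult_zero_left)

lemma frobenius_bit_closure: "(x + y :: bit alg_closure) ^ (2 ^ m) = x ^ (2 ^ m) + y ^ (2 ^ m)"
proof (induction m)
  case (Suc m)
  have "(x + y) ^ (2 ^ Suc m) = ((x + y) ^ (2 ^ m))\<^sup>2"
    by (metis power_Suc2 power_mult)
  also have "\<dots> = (x ^ (2 ^ m) + y ^ (2 ^ m))\<^sup>2" by (simp only: Suc)
  also have "\<dots> = (x ^ (2 ^ m))\<^sup>2 + (y ^ (2 ^ m))\<^sup>2"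
    by (simp add: power2_sum two_eq_0_bit_closure)
  also have "\<dots> = x ^ (2 ^ Suc m) + y ^ (2 ^ Suc m)"
    by (metis power_Suc2 power_mult)
  finally show ?case .
qed simp

text \<open>The field consists of the roots of X^q - X, the fixed points of a power of the Frobenius
  map. The derivative of this polynomial is the constant -1, so all q roots are simple.\<close>

lemma finite_subfield_bit_closure:
  assumes "m \<ge> 1"
  obtains K :: "bit alg_closure set" where "subfield_set K" "finite K" "card K = 2 ^ m"
proof -
  define q :: nat where "q = 2 ^ m"
  have q2: "q \<ge> 2" using assms unfolding q_def
    by (metis power_increasing power_one_right one_le_numeral)
  define K where "K = {x :: bit alg_closure. x ^ q = x}"
  define p :: "bit alg_closure poly" where "p = monom 1 q - monom 1 1"
  have q0: "(of_nat q :: bit alg_closure) = 0"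
    using assms two_eq_0_bit_closure by (simp add: q_def)
  have K: "poly p x = 0 \<longleftrightarrow> x \<in> K" for x by (simp add: p_def K_def poly_monom)
  have degp: "degree p = q" unfolding p_def using q2 
    by (subst diff_conv_add_uminus, subst degree_add_eq_left) (auto simp: degree_monom_eq)
  have p0: "p \<noteq> 0" using degp q2 by auto
  have lc: "lead_coeff p = 1" using q2 unfolding degp by (simp add: p_def)
  have der: "poly (pderiv p) x = -1" for x
    by (simp add: p_def pderiv_diff pderiv_monom poly_monom q0)
  obtain A where A: "size A = q" "p = (\<Prod>x\<in>#A. [:-x, 1:])"
    using alg_closed_imp_factorization[OF p0] degp lc by auto
  have "count A x \<le> 1" for x
  proof (rule ccontr)
    assume "\<not> count A x \<le> 1"
    then have "replicate_mset 2 x \<subseteq># A"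
      by (simp add: count_le_replicate_mset_subset_eq flip: count_le_replicate_mset_subset_eq)
    then obtain B where "A = replicate_mset 2 x + B" by (metis subset_mset.le_iff_add)
    then have "p = [:-x, 1:] * ([:-x, 1:] * (\<Prod>x\<in>#B. [:-x, 1:]))"
      using A by (simp add: numeral_2_eq_2)
    then have "poly (pderiv p) x = 0" by (simp only: pderiv_mult) simp
    then show False using der by simp
  qed
  then have "A = mset_set (set_mset A)"
    by (intro multiset_eqI) (metis count_mset_set(1,3) count_eq_zero_iff finite_set_mset
        le_antisym One_nat_def Suc_leI not_gr_zero)
  then have "card (set_mset A) = q" using A by (metis size_mset_set)
  moreover have "set_mset A = K"
    using A(2) K by (auto simp: poly_prod_mset prod_mset_zero_iff image_iff)
  ultimately have c: "card K = q" "finite K" by auto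
  have "subfield_set K"
    unfolding subfield_set_def K_def using q2
    by (auto simp: q_def frobenius_bit_closure power_mult_distrib power_inverse
        uminus_bit_closure)
  then show ?thesis using that c by (simp add: q_def)
qed

subsection \<open>Matrices over power series\<close>

datatype 'a mat2 = Mat2 (m11: 'a) (m12: 'a) (m21: 'a) (m22: 'a)

instantiation mat2 :: (comm_ring_1) ring_1
begin

definition "0 = Mat2 0 0 0 0"
definition "1 = Mat2 1 0 0 1"
definition "A + B = Mat2 (m11 A + m11 B) (m12 A + m12 B) (m21 A + m21 B) (m22 A + m22 B)"
definition "A - B = Mat2 (m11 A - m11 B) (m12 A - m12 B) (m21 A - m21 B) (m22 A - m22 B)"
definition "- A = Mat2 (- m11 A) (- m12 A) (- m21 A) (- m22 A)"
definition "A * B = Mat2 (m11 A * m11 B + m12 A * m21 B) (m11 A * m12 B + m12 A * m22 B)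
  (m21 A * m11 B + m22 A * m21 B) (m21 A * m12 B + m22 A * m22 B)"

lemmas mat2_defs = zero_mat2_def one_mat2_def plus_mat2_def minus_mat2_def uminus_mat2_def
  times_mat2_def

instance
  by standard (auto simp: mat2_defs algebra_simps mat2.expand)

end

lemma mat2_sel [simp]:
  "m11 (A + B) = m11 A + m11 B" "m12 (A + B) = m12 A + m12 B"
  "m21 (A + B) = m21 A + m21 B" "m22 (A + B) = m22 A + m22 B"
  "m11 (A - B) = m11 A - m11 B" "m12 (A - B) = m12 A - m12 B"
  "m21 (A - B) = m21 A - m21 B" "m22 (A - B) = m22 A - m22 B"
  "m11 (A * B) = m11 A * m11 B + m12 A * m21 B" "m12 (A * B) = m11 A * m12 B + m12 A * m22 B"
  "m21 (A * B) = m21 A * m11 B + m22 A * m21 B" "m22 (A * B) = m21 A * m12 B + m22 A * m22 B"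
  "m11 1 = 1" "m12 1 = 0" "m21 1 = 0" "m22 1 = 1"
  "m11 0 = 0" "m12 0 = 0" "m21 0 = 0" "m22 0 = 0"
  by (simp_all add: mat2_defs)

definition det2 :: "'a::comm_ring_1 mat2 \<Rightarrow> 'a" where
  "det2 A = m11 A * m22 A - m12 A * m21 A"

text \<open>The adjugate is the inverse when the determinant is 1, and it needs no division.\<close>

definition adj2 :: "'a::comm_ring_1 mat2 \<Rightarrow> 'a mat2" where
  "adj2 A = Mat2 (m22 A) (- m12 A) (- m21 A) (m11 A)"

lemma adj2_sel [simp]: "m11 (adj2 A) = m22 A" "m12 (adj2 A) = - m12 A"
  "m21 (adj2 A) = - m21 A" "m22 (adj2 A) = m11 A"
  by (simp_all add: adj2_def)

lemma adj2_mult: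
  "adj2 A * A = Mat2 (det2 A) 0 0 (det2 A)" "A * adj2 A = Mat2 (det2 A) 0 0 (det2 A)"
  by (simp_all add: adj2_def det2_def times_mat2_def algebra_simps)

lemma det2_mult: "det2 (A * B) = det2 A * det2 B"
  by (simp add: det2_def algebra_simps)

section \<open>Power series modulo powers of z\<close>

definition vanishes :: "nat \<Rightarrow> 'a::zero fps \<Rightarrow> bool" where
  "vanishes n f \<longleftrightarrow> (\<forall>i<n. fps_nth f i = 0)"

lemma vanishes_0 [simp]: "vanishes n 0" by (simp add: vanishes_def)

lemma vanishes_mono: "vanishes n f \<Longrightarrow> m \<le> n \<Longrightarrow> vanishes m f"
  by (auto simp: vanishes_def)

lemma vanishes_nth: "vanishes n f \<Longrightarrow> i < n \<Longrightarrow> fps_nth f i = 0"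
  by (auto simp: vanishes_def)

context
  fixes f g :: "'a::comm_ring_1 fps"
begin

lemma vanishes_add: "vanishes n f \<Longrightarrow> vanishes n g \<Longrightarrow> vanishes n (f + g)"
  by (simp add: vanishes_def)

lemma vanishes_uminus [simp]: "vanishes n (- f) \<longleftrightarrow> vanishes n f"
  by (simp add: vanishes_def)

lemma vanishes_diff: "vanishes n f \<Longrightarrow> vanishes n g \<Longrightarrow> vanishes n (f - g)"
  by (simp add: vanishes_def)

lemma vanishes_mult_add: "vanishes n f \<Longrightarrow> vanishes m g \<Longrightarrow> vanishes (n + m) (f * g)"
  unfolding vanishes_def fps_mult_nth
proof (intro allI impI sum.neutral ballI)
  fix i j
  assume *: "\<forall>i<n. fps_nth f i = 0" "\<forall>i<m. fps_nth g i = 0" "i < n + m" "j \<in> {0..i}"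
  then have "j < n \<or> i - j < m" by auto
  then show "fps_nth f j * fps_nth g (i - j) = 0" using * by auto
qed

lemma vanishes_mult1: "vanishes n f \<Longrightarrow> vanishes n (f * g)"
  unfolding vanishes_def fps_mult_nth by (intro allI impI sum.neutral) auto

lemma vanishes_mult2: "vanishes n g \<Longrightarrow> vanishes n (f * g)"
  unfolding vanishes_def fps_mult_nth by (intro allI impI sum.neutral) auto

end

lemma vanishes_cancel:
  fixes f u :: "'a::field fps"
  assumes "vanishes n (u * f)" "fps_nth u 0 \<noteq> 0"
  shows "vanishes n f"
proof -
  have "f = inverse u * (u * f)" using assms(2) by (simp add: inverse_mult_eq_1 flip: mult.assoc)
  then show ?thesis using vanishes_mult2[OF assms(1)] by metis
qed

text \<open>Substituting a series of order 1 keeps the order of a power series.\<close>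

lemma vanishes_compose:
  fixes f t :: "'a::field fps"
  assumes "vanishes n (f oo t)" "subdegree t = 1"
  shows "vanishes n f"
proof (cases "f = 0")
  case False
  have t0: "fps_nth t 0 = 0" by (rule nth_less_subdegree_zero) (simp add: assms(2))
  have "t \<noteq> 0" using assms(2) by auto
  then have ne: "f oo t \<noteq> 0" using False t0 fps_compose_eq_0_iff[of t f] by blast
  have sd: "subdegree (f oo t) = subdegree f" using subdegree_fps_compose[OF t0, of f] assms(2)
    by simp
  have "\<not> subdegree (f oo t) < n"
    using vanishes_nth[OF assms(1)] nth_subdegree_nonzero[OF ne] by blast
  then show ?thesis unfolding sd vanishes_def
    by (meson nth_less_subdegree_zero less_le_trans not_le)
qed simp

definition upper :: "'a::field \<Rightarrow> 'a fps mat2" where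
  "upper s = Mat2 1 (fps_const s) 0 1"

text \<open>The factor z keeps these matrices upper unitriangular modulo z.\<close>

definition lower :: "'a::field \<Rightarrow> 'a fps mat2" where
  "lower t = Mat2 1 0 (fps_const t * fps_X) 1"

text \<open>The group before truncation. The constant term 1 at position (2,2) follows from the
  determinant.\<close>

definition unip :: "'a::field fps mat2 \<Rightarrow> bool" where
  "unip A \<longleftrightarrow> det2 A = 1 \<and> fps_nth (m11 A) 0 = 1 \<and> fps_nth (m21 A) 0 = 0"

lemma upper_sel [simp]: "m11 (upper s) = 1" "m12 (upper s) = fps_const s"
    "m21 (upper s) = 0" "m22 (upper s) = 1"
  and lower_sel [simp]: "m11 (lower t) = 1" "m12 (lower t) = 0"
    "m21 (lower t) = fps_const t * fps_X" "m22 (lower t) = 1"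
  by (simp_all add: upper_def lower_def)

lemma unip_m22: "unip A \<Longrightarrow> fps_nth (m22 A) 0 = 1"
  unfolding unip_def det2_def by (metis fps_mult_nth_0 fps_one_nth fps_sub_nth mult_1
      mult_zero_right diff_zero)

lemma unip_mult: "unip A \<Longrightarrow> unip B \<Longrightarrow> unip (A * B)"
  using unip_m22[of A] by (simp add: unip_def det2_mult)

lemma unip_adj2: "unip A \<Longrightarrow> unip (adj2 A)"
  using unip_m22[of A] by (simp add: unip_def det2_def mult.commute)

lemma unip_upper [simp]: "unip (upper s)"
  and unip_lower [simp]: "unip (lower t)"
  by (simp_all add: unip_def det2_def)

lemma unip_inverse: "unip A \<Longrightarrow> adj2 A * A = 1" "unip A \<Longrightarrow> A * adj2 A = 1"
  by (simp_all add: adj2_mult unip_def one_mat2_def)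

lemma upper_add: "upper (s + s') = upper s * upper s'"
  by (simp add: upper_def times_mat2_def add.commute)

lemma lower_add: "lower (t + t') = lower t * lower t'"
  by (simp add: lower_def times_mat2_def algebra_simps flip: fps_const_add)

lemma upper_0 [simp]: "upper 0 = 1" and lower_0 [simp]: "lower 0 = 1"
  by (simp_all add: upper_def lower_def one_mat2_def)

text \<open>
  The entry at $(1,2)$ may be truncated one step earlier than the others, since the lower left
  entries that multiply it are divisible by $z$. For even $k$ this saves one factor $q$ in $|U|$.
\<close>

locale truncation =
  fixes n n' :: nat
  assumes n: "n' \<le> n" "n \<le> Suc n'"
begin

definition small :: "'a::field fps mat2 \<Rightarrow> bool" where
  "small A \<longleftrightarrow> vanishes n (m11 A) \<and> vanishes n' (m12 A) \<and> vanishes n (m21 A) \<and> vanishes n (m22 A)"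

text \<open>The truncated group is never formed as a quotient. Its equations are congruences between
  \<open>unip\<close> matrices, and factors from this group can be multiplied and cancelled on both
  sides.\<close>

definition cong2 :: "'a::field fps mat2 \<Rightarrow> 'a fps mat2 \<Rightarrow> bool" (infix "\<doteq>" 50) where
  "A \<doteq> B \<longleftrightarrow> small (A - B)"

lemma small_add: "small A \<Longrightarrow> small B \<Longrightarrow> small (A + B)"
  by (simp add: small_def vanishes_add)

lemma small_uminus: "small A \<Longrightarrow> small (- A)"
  by (simp add: small_def uminus_mat2_def)

lemma vanishes_m12_times:
  assumes "vanishes n' f" "fps_nth g 0 = (0::'a::field)"
  shows "vanishes n (f * g)" "vanishes n (g * f)"
proof -
  have "vanishes 1 g" using assms(2) by (simp add: vanishes_def)
  then have "vanishes (n' + 1) (f * g)" by (intro vanishes_mult_add assms(1))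
  then show "vanishes n (f * g)" using n by (auto elim!: vanishes_mono)
  then show "vanishes n (g * f)" by (simp add: mult.commute)
qed

lemma small_mult:
  assumes "small A" "fps_nth (m21 B) 0 = 0"
  shows "small (A * B)" "small (B * A)"
proof -
  have "vanishes n' (m11 A)" "vanishes n' (m22 A)"
    using assms(1) n by (auto simp: small_def elim: vanishes_mono)
  then show "small (A * B)" "small (B * A)"
    using assms by (simp_all add: small_def vanishes_add vanishes_mult1 vanishes_mult2
        vanishes_m12_times)
qed

lemma cong2_refl [simp]: "A \<doteq> A"
  by (simp add: cong2_def small_def)

lemma cong2_sym: "A \<doteq> B \<Longrightarrow> B \<doteq> A"
  using small_uminus[of "A - B"] by (simp add: cong2_def)

lemma cong2_trans [trans]: "A \<doteq> B \<Longrightarrow> B \<doteq> C \<Longrightarrow> A \<doteq> C"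
  using small_add[of "A - B" "B - C"] by (simp add: cong2_def)

lemma cong2_mult_left: "A \<doteq> B \<Longrightarrow> unip C \<Longrightarrow> C * A \<doteq> C * B"
  using small_mult(2)[of "A - B" C] by (simp add: cong2_def unip_def right_diff_distrib)

lemma cong2_mult_right: "A \<doteq> B \<Longrightarrow> unip C \<Longrightarrow> A * C \<doteq> B * C"
  using small_mult(1)[of "A - B" C] by (simp add: cong2_def unip_def left_diff_distrib)

lemma cong2_cancel_left: "C * A \<doteq> C * B \<Longrightarrow> unip C \<Longrightarrow> A \<doteq> B"
  using cong2_mult_left[of "C * A" "C * B" "adj2 C"]
      by (simp add: unip_inverse unip_adj2 flip: mult.assoc)

lemma cong2_cancel_right: "A * C \<doteq> B * C \<Longrightarrow> unip C \<Longrightarrow> A \<doteq> B"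
  using cong2_mult_right[of "A * C" "B * C" "adj2 C"]
      by (simp add: unip_inverse unip_adj2 mult.assoc)

end

section \<open>Alternating words\<close>

text \<open>
  In the algebra with generators $a, b$ and relations $a^2 = b^2 = 0$, a product of factors $1 + s a$
  and $1 + s b$ is a combination of alternating monomials. Its coefficient at the monomial of degree
  \<open>d\<close> with leftmost letter $a$ (if \<open>b\<close> is true) or $b$ is \<open>word_coeff e s m b d\<close>.
\<close>

fun word_coeff :: "(nat \<Rightarrow> bool) \<Rightarrow> (nat \<Rightarrow> 'a::field) \<Rightarrow> nat \<Rightarrow> bool \<Rightarrow> nat \<Rightarrow> 'a" where
  "word_coeff e s 0 b d = (if d = 0 then 1 else 0)"
| "word_coeff e s (Suc m) b d = word_coeff e s m b d +
     (if b = e m \<and> d > 0 then s m * word_coeff e s m (\<not> b) (d - 1) else 0)"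

text \<open>The factor with index m is the leftmost one. When the letters alternate, a monomial of
  degree m + 1 must use all factors, so it starts with the letter \<open>e m\<close> and its
  coefficient is the product of all parameters. The three claims support each other in the
  induction.\<close>

lemma word_coeff_top:
  assumes "\<And>j. e (Suc j) = (\<not> e j)" and "\<And>j. s j \<noteq> 0"
  shows "word_coeff e s (Suc m) (e m) (Suc m) \<noteq> 0"
    and "d > Suc m \<Longrightarrow> word_coeff e s (Suc m) (e m) d = 0"
    and "d \<ge> Suc m \<Longrightarrow> word_coeff e s (Suc m) (\<not> e m) d = 0"
proof -
  have "word_coeff e s (Suc m) (e m) (Suc m) \<noteq> 0 \<and> (\<forall>d>Suc m. word_coeff e s (Suc m) (e m) d = 0)
    \<and> (\<forall>d\<ge>Suc m. word_coeff e s (Suc m) (\<not> e m) d = 0)"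
  proof (induction m)
    case (Suc m)
    have 1: "word_coeff e s (Suc (Suc m)) (\<not> e (Suc m)) d = word_coeff e s (Suc m) (e m) d" for d
      using assms(1)[of m] by (subst word_coeff.simps) simp
    have 2: "word_coeff e s (Suc (Suc m)) (e (Suc m)) (Suc d) =
       word_coeff e s (Suc m) (\<not> e m) (Suc d) + s (Suc m) * word_coeff e s (Suc m) (e m) d" for d
      using assms(1)[of m] by (subst word_coeff.simps) simp
    have 3: "word_coeff e s (Suc (Suc m)) (e (Suc m)) d = 0" if "d > Suc (Suc m)" for d
    proof -
      obtain d' where "d = Suc d'" using \<open>d > Suc (Suc m)\<close> by (cases d) auto
      then show ?thesis using 2[of d'] Suc that by (simp del: word_coeff.simps)
    qed
    show ?case using 1 2[of "Suc m"] 3 Suc assms(2) by (simp del: word_coeff.simps)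
  qed (use assms in auto)
  then show "word_coeff e s (Suc m) (e m) (Suc m) \<noteq> 0"
    "d > Suc m \<Longrightarrow> word_coeff e s (Suc m) (e m) d = 0"
    "d \<ge> Suc m \<Longrightarrow> word_coeff e s (Suc m) (\<not> e m) d = 0" by blast+
qed

text \<open>In the basis chosen below, monomials of even degree become diagonal matrices and those
  of odd degree antidiagonal ones, and two letters together contribute one factor
  \<open>\<tau>\<close>. Hence one power series for each parity.\<close>

definition evens :: "(nat \<Rightarrow> 'a) \<Rightarrow> 'a fps" where "evens c = Abs_fps (\<lambda>i. c (2 * i))"
definition odds :: "(nat \<Rightarrow> 'a) \<Rightarrow> 'a fps" where "odds c = Abs_fps (\<lambda>i. c (2 * i + 1))"

lemma evens_odds_word_coeff:
  assumes "b = e m"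
  shows "evens (word_coeff e s (Suc m) b) =
      evens (word_coeff e s m b) + fps_const (s m) * fps_X * odds (word_coeff e s m (\<not> b))"
    and "odds (word_coeff e s (Suc m) b) =
      odds (word_coeff e s m b) + fps_const (s m) * evens (word_coeff e s m (\<not> b))"
    and "evens (word_coeff e s (Suc m) (\<not> b)) = evens (word_coeff e s m (\<not> b))"
    and "odds (word_coeff e s (Suc m) (\<not> b)) = odds (word_coeff e s m (\<not> b))"
proof -
  show "evens (word_coeff e s (Suc m) b) =
      evens (word_coeff e s m b) + fps_const (s m) * fps_X * odds (word_coeff e s m (\<not> b))"
  proof (rule fps_ext)
    fix i
    show "fps_nth (evens (word_coeff e s (Suc m) b)) i = fps_nth (evens (word_coeff e s m b) +
       fps_const (s m) * fps_X * odds (word_coeff e s m (\<not> b))) i"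
      using assms by (cases i) (simp_all add: evens_def odds_def mult.assoc)
  qed
qed (use assms in \<open>auto simp: evens_def odds_def fps_eq_iff\<close>)

fun word :: "'a::field fps mat2 \<Rightarrow> (nat \<Rightarrow> bool) \<Rightarrow> (nat \<Rightarrow> 'a) \<Rightarrow> nat \<Rightarrow> 'a fps mat2" where
  "word x e s 0 = 1"
| "word x e s (Suc m) = (if e m then upper (s m) else x * lower (s m) * adj2 x) * word x e s m"

text \<open>
  In the basis consisting of the first unit vector and the image of the second one under \<open>x\<close>, both
  kinds of letters are elementary up to units, and \<open>\<tau>\<close> takes the role of $z$.
\<close>

lemma word_normal_form:
  fixes x :: "'a::field fps mat2"
  assumes x: "unip x"
  defines "l \<equiv> m22 x"
  defines "\<tau> \<equiv> fps_X * l * l" and "y \<equiv> Mat2 1 (m12 x) 0 l"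
  shows "word x e s m * y = y * Mat2 (evens (word_coeff e s m True) oo \<tau>) (l * (odds
      (word_coeff e s m True) oo \<tau>))
     (fps_X * l * (odds (word_coeff e s m False) oo \<tau>)) (evens (word_coeff e s m False) oo \<tau>)"
proof (induction m)
  case 0
  have *: "evens (word_coeff e s 0 b) = 1" "odds (word_coeff e s 0 b) = 0" for b
    by (auto simp: evens_def odds_def fps_eq_iff)
  show ?case by (simp add: * del: word_coeff.simps flip: one_mat2_def)
next
  case (Suc m)
  have \<tau>0: "fps_nth \<tau> 0 = 0" by (simp add: \<tau>_def)
  \<comment> \<open>The nilpotent part of a conjugated letter is t z times the product of the second
    column of x and the row (l, -\<open>m12 x\<close>), so it involves only that column.\<close>
  have xa: "x * lower t * adj2 x = 1 + Mat2 (fps_const t * fps_X * m12 x * l) (-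
      (fps_const t * fps_X * m12 x * m12 x))
     (fps_const t * fps_X * l * l) (- (fps_const t * fps_X * m12 x * l))" for t
  proof -
    have "x * lower t * adj2 x = Mat2 (det2 x) 0 0 (det2 x) + Mat2 (fps_const t * fps_X * m12 x
        * l)
       (- (fps_const t * fps_X * m12 x * m12 x)) (fps_const t * fps_X * l * l) (-
         (fps_const t * fps_X * m12 x * l))"
      by (simp add: mat2.expand det2_def l_def algebra_simps)
    then show ?thesis using x by (simp add: unip_def one_mat2_def)
  qed
  \<comment> \<open>In the basis \<open>y\<close> a letter on the left is a single row operation,
    and its effect on the four entries is the recursion for the coefficients with
    \<open>\<tau>\<close> substituted.\<close>
  have up: "upper t * (y * Mat2 w (l * p) (fps_X * l * q) u) =
      y * Mat2 (w + fps_const t * \<tau> * q) (l * (p + fps_const t * u))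
          (fps_X * l * q) u" for t w p q u
    by (simp add: mat2.expand y_def \<tau>_def algebra_simps)
  have low: "x * lower t * adj2 x * (y * Mat2 w (l * p) (fps_X * l * q) u) =
      y * Mat2 w (l * p) (fps_X * l * (q + fps_const t * w))
          (u + fps_const t * \<tau> * p)" for t w p q u
    unfolding xa by (simp add: mat2.expand y_def \<tau>_def algebra_simps)
  note cs = evens_odds_word_coeff[OF refl, where e = e and m = m and s = s]
  define c where "c = word_coeff e s m"
  define c' where "c' = word_coeff e s (Suc m)"
  note cs' = cs[folded c_def c'_def]
  show ?case
  proof (cases "e m")
    case True
    have 1: "evens (c' True) oo \<tau> = (evens (c True) oo \<tau>) + fps_const (s m) * \<tau> * (odds
        (c False) oo \<tau>)"
      "odds (c' True) oo \<tau> = (odds (c True) oo \<tau>) + fps_const (s m) * (evens (c False) oo \<tau>)"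
      "evens (c' False) = evens (c False)" "odds (c' False) = odds (c False)"
      using cs' True by (simp_all add: fps_compose_add_distrib fps_compose_mult_distrib[OF \<tau>0] \<tau>0)
    have "word x e s (Suc m) * y = upper (s m) * (word x e s m * y)"
      using True by (simp add: mult.assoc)
    also have "\<dots> = upper (s m) * (y * Mat2 (evens (c True) oo \<tau>) (l * (odds (c True) oo \<tau>))
     (fps_X * l * (odds (c False) oo \<tau>)) (evens (c False) oo \<tau>))"
      by (simp only: Suc c_def)
    also have "\<dots> = y * Mat2 (evens (c' True) oo \<tau>) (l * (odds (c' True) oo \<tau>))
     (fps_X * l * (odds (c' False) oo \<tau>)) (evens (c' False) oo \<tau>)"
      unfolding 1 by (rule up)
    finally show ?thesis by (simp only: c'_def)
  next
    case False
    have 1: "evens (c' False) oo \<tau> = (evens (c False) oo \<tau>) + fps_const (s m) * \<tau> * (odds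
        (c True) oo \<tau>)"
      "odds (c' False) oo \<tau> = (odds (c False) oo \<tau>) + fps_const (s m) * (evens (c True) oo \<tau>)"
      "evens (c' True) = evens (c True)" "odds (c' True) = odds (c True)"
      using cs' False by (simp_all add: fps_compose_add_distrib fps_compose_mult_distrib[OF \<tau>0]
          \<tau>0)
    have "word x e s (Suc m) * y = x * lower (s m) * adj2 x * (word x e s m * y)"
      using False by (simp add: mult.assoc)
    also have "\<dots> = x * lower (s m) * adj2 x * (y * Mat2 (evens (c True) oo \<tau>) (l * (odds
        (c True) oo \<tau>))
     (fps_X * l * (odds (c False) oo \<tau>)) (evens (c False) oo \<tau>))"
      by (simp only: Suc c_def)
    also have "\<dots> = y * Mat2 (evens (c' True) oo \<tau>) (l * (odds (c' True) oo \<tau>))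
     (fps_X * l * (odds (c' False) oo \<tau>)) (evens (c' False) oo \<tau>)"
      unfolding 1 by (rule low)
    finally show ?thesis by (simp only: c'_def)
  qed
qed

text \<open>The normal forms of congruent words are congruent up to unit factors. Neither these
  units nor the substitution of \<open>\<tau>\<close>, which has order 1, changes the order of
  vanishing. So the coefficients can be read off from the first row, even degrees at (1,1) and odd
  degrees at (1,2).\<close>

lemma (in truncation) word_top_coeffs:
  fixes x :: "'a::field fps mat2"
  assumes x: "unip x" and eq: "word x e s m \<doteq> word x e' s' m"
  shows "i < n \<Longrightarrow> word_coeff e s m True (2 * i) = word_coeff e' s' m True (2 * i)"
    and "i < n' \<Longrightarrow> word_coeff e s m True (2 * i + 1) = word_coeff e' s' m True (2 * i + 1)"
proof -
  define l where "l = m22 x"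
  define \<tau> where "\<tau> = fps_X * l * l"
  define y where "y = Mat2 1 (m12 x) 0 l"
  have l0: "fps_nth l 0 = 1" unfolding l_def by (rule unip_m22[OF x])
  then have l_ne: "l \<noteq> 0" by auto
  have "subdegree l = 0" using l0 by simp
  then have \<tau>: "subdegree \<tau> = 1" using l_ne by (simp add: \<tau>_def)
  define D where "D = (\<lambda>e s m. Mat2 (evens (word_coeff e s m True) oo \<tau>) (l * (odds
      (word_coeff e s m True) oo \<tau>))
     (fps_X * l * (odds (word_coeff e s m False) oo \<tau>)) (evens (word_coeff e s m False) oo \<tau>))"
  have W: "word x e s m * y = y * D e s m" for e s m
    using word_normal_form[OF x] by (simp add: D_def y_def \<tau>_def l_def)
  \<comment> \<open>The determinant of \<open>y\<close> is l and not 1, so multiplying by the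
    adjugate leaves the unit l as a scalar factor.\<close>
  have "small (adj2 y * ((word x e s m - word x e' s' m) * y))"
    using eq by (intro small_mult) (auto simp: cong2_def y_def)
  also have "adj2 y * ((word x e s m - word x e' s' m) * y) = adj2 y * y * (D e s m - D e' s' m)"
    by (simp add: left_diff_distrib right_diff_distrib W mult.assoc)
  also have "adj2 y * y = Mat2 l 0 0 l" by (simp add: adj2_mult y_def det2_def)
  finally have sm: "small (Mat2 l 0 0 l * (D e s m - D e' s' m))" .
  let ?c = "word_coeff e s m True" and ?c' = "word_coeff e' s' m True"
  have "vanishes n (l * ((evens ?c - evens ?c') oo \<tau>))"
    using sm by (simp add: small_def D_def fps_compose_sub_distrib)
  then have "vanishes n ((evens ?c - evens ?c') oo \<tau>)" by (rule vanishes_cancel) (simp add: l0)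
  then have "vanishes n (evens ?c - evens ?c')" by (rule vanishes_compose[OF _ \<tau>])
  then show "i < n \<Longrightarrow> ?c (2 * i) = ?c' (2 * i)"
    by (auto simp: vanishes_def evens_def)
  have "vanishes n' ((l * l) * ((odds ?c - odds ?c') oo \<tau>))"
    using sm by (simp add: small_def D_def fps_compose_sub_distrib algebra_simps)
  then have "vanishes n' ((odds ?c - odds ?c') oo \<tau>)" by (rule vanishes_cancel) (simp add: l0)
  then have "vanishes n' (odds ?c - odds ?c')" by (rule vanishes_compose[OF _ \<tau>])
  then show "i < n' \<Longrightarrow> ?c (2 * i + 1) = ?c' (2 * i + 1)"
    by (auto simp: vanishes_def odds_def)
qed

subsection \<open>Colouring points against lines\<close>

text \<open>The element \<open>F k\<close> is reached from \<open>F 0\<close> by k steps forward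
  and, as the walk is closed, by k inverse steps backward. The two words have different kinds of
  leftmost letters, so exactly one of them has a nonzero coefficient at the monomial of degree k
  that starts with the letter of \<open>upper\<close>.\<close>

lemma (in truncation) no_closed_walk:
  fixes x :: "'a::field fps mat2" and F :: "nat \<Rightarrow> 'a fps mat2"
  assumes x: "unip x" and F: "\<And>j. unip (F j)"
    and e: "\<And>j. e (Suc j) = (\<not> e j)" and s: "\<And>j. s j \<noteq> 0"
    and step: "\<And>j. F (Suc j) \<doteq> (if e j then upper (s j) else x * lower (s j) * adj2 x) * F j"
    and closed: "F (2 * k) = F 0" and "k \<ge> 1" and k: "n = k div 2 + 1" "n' = Suc k div 2"
  shows False
proof -
  define lt where "lt = (\<lambda>b t. if b then upper t else x * lower t * adj2 x)"
  have lt: "unip (lt b t)" for b t using x by (auto simp: lt_def intro!: unip_mult unip_adj2)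
  have lt_inv: "lt b (- t) * lt b t = 1" for b t
  proof (cases b)
    case True
    then show ?thesis by (simp add: lt_def flip: upper_add)
  next
    case False
    have "x * lower (- t) * adj2 x * (x * lower t * adj2 x)
        = x * lower (- t) * (adj2 x * x) * lower t * adj2 x"
      by (simp add: mult.assoc)
    also have "\<dots> = x * (lower (- t) * lower t) * adj2 x" by (simp add: unip_inverse x mult.assoc)
    also have "\<dots> = 1" by (simp add: unip_inverse x flip: lower_add)
    finally show ?thesis using False by (simp add: lt_def)
  qed
  have word: "word x e' s' (Suc m) = lt (e' m) (s' m) * word x e' s' m" for e' s' m
    by (simp add: lt_def)
  have step: "F (Suc j) \<doteq> lt (e j) (s j) * F j" for j
    using step by (simp add: lt_def)
  have fwd: "F m \<doteq> word x e s m * F 0" for m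
  proof (induction m)
    case (Suc m)
    have "F (Suc m) \<doteq> lt (e m) (s m) * F m" by (rule step)
    also have "\<dots> \<doteq> lt (e m) (s m) * (word x e s m * F 0)" by (intro cong2_mult_left Suc lt)
    finally show ?case by (simp only: word mult.assoc)
  qed simp
  \<comment> \<open>The backward step m undoes the step 2k - 1 - m, whose parity is opposite to that
    of m. So the kinds of letters are complemented, and the parameters are negated because the
    letters are inverted.\<close>
  define e' where "e' j = (\<not> e j)" for j
  define s' where "s' j = - s (2 * k - 1 - j)" for j
  have par: "e j \<longleftrightarrow> (e 0 \<longleftrightarrow> even j)" for j by (induction j) (auto simp: e)
  have bwd: "m \<le> 2 * k \<Longrightarrow> F (2 * k - m) \<doteq> word x e' s' m * F 0" for m
  proof (induction m)
    case 0
    then show ?case by (simp add: closed)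
  next
    case (Suc m)
    define j where "j = 2 * k - 1 - m"
    have j: "2 * k - m = Suc j" "2 * k - Suc m = j" using Suc.prems by (auto simp: j_def)
    have "F (Suc j) \<doteq> lt (e j) (s j) * F j" by (rule step)
    then have "lt (e j) (- s j) * (lt (e j) (s j) * F j) \<doteq> lt (e j) (- s j) * F (Suc j)"
      by (intro cong2_mult_left lt) (rule cong2_sym)
    then have "F j \<doteq> lt (e j) (- s j) * F (Suc j)" by (simp add: lt_inv flip: mult.assoc)
    also have "\<dots> \<doteq> lt (e j) (- s j) * (word x e' s' m * F 0)"
      using Suc j by (intro cong2_mult_left lt) simp
    also have "e j = e' m" using Suc.prems par[of j] par[of m] unfolding e'_def j_def by auto
    also have "lt (e' m) (- s j) * (word x e' s' m * F 0) = word x e' s' (Suc m) * F 0"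
      by (simp add: word s'_def j_def mult.assoc del: word.simps)
    finally show ?case by (simp only: j)
  qed
  obtain m where Suc: "k = Suc m" using \<open>k \<ge> 1\<close> by (cases k) auto
  have e': "e' (Suc j) = (\<not> e' j)" for j using e by (simp add: e'_def)
  have s': "s' j \<noteq> 0" for j using s by (simp add: s'_def)
  have "word x e s k * F 0 \<doteq> word x e' s' k * F 0"
    using fwd[of k] bwd[of k] by (auto intro: cong2_trans cong2_sym)
  then have W: "word x e s k \<doteq> word x e' s' k" by (rule cong2_cancel_right) (rule F)
  note top = word_coeff_top[where e = e and s = s and m = m, OF e s, folded Suc]
  note top' = word_coeff_top[where e = e' and s = s' and m = m, OF e' s', folded Suc]
  have ne: "word_coeff e s k True k \<noteq> word_coeff e' s' k True k"
    using top(1) top'(1) top(3)[of k] top'(3)[of k] by (cases "e m") (auto simp: e'_def)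
  \<comment> \<open>For k = 2i the coefficient has index i = n - 1 in \<open>evens\<close>, for k =
    2i + 1 it has index i = n' - 1 in \<open>odds\<close>. In both cases this is the last one that
    is kept.\<close>
  show False
  proof (cases "even k")
    case True
    then obtain i where "k = 2 * i" by auto
    then show False using word_top_coeffs(1)[OF x W, of i] ne k by simp
  next
    case False
    then obtain i where "k = 2 * i + 1" by (auto elim: oddE)
    then show False using word_top_coeffs(2)[OF x W, of i] ne k by simp
  qed
qed

section \<open>Power series with coefficients in a finite subfield\<close>

definition coeffs_in :: "'a::zero set \<Rightarrow> nat \<Rightarrow> nat \<Rightarrow> 'a fps set" where
  "coeffs_in K lo hi = {f. range (fps_nth f) \<subseteq> K \<and> (\<forall>i. i < lo \<or> hi \<le> i \<longrightarrow> fps_nth f i = 0)}"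

lemma coeffs_in_card:
  assumes "finite K" "(0::'a::zero) \<in> K"
  shows "finite (coeffs_in K lo hi)" "card (coeffs_in K lo hi) = card K ^ (hi - lo)"
proof -
  define r where "r = (\<lambda>f :: 'a fps. restrict (fps_nth f) {lo..<hi})"
  have "bij_betw r (coeffs_in K lo hi) ({lo..<hi} \<rightarrow>\<^sub>E K)"
  proof (rule bij_betw_byWitness[where f' = "\<lambda>c. Abs_fps (\<lambda>i. if i \<in> {lo..<hi} then c i else 0)"])
    show "\<forall>a\<in>coeffs_in K lo hi. Abs_fps (\<lambda>i. if i \<in> {lo..<hi} then r a i else 0) = a"
      by (auto simp: coeffs_in_def r_def fps_eq_iff not_less not_le)
    show "\<forall>c\<in>{lo..<hi} \<rightarrow>\<^sub>E K. r (Abs_fps (\<lambda>i. if i \<in> {lo..<hi} then c i else 0)) = c"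
      by (auto simp: r_def PiE_iff extensional_def)
    show "r ` coeffs_in K lo hi \<subseteq> {lo..<hi} \<rightarrow>\<^sub>E K"
      by (auto simp: coeffs_in_def r_def)
    show "(\<lambda>c. Abs_fps (\<lambda>i. if i \<in> {lo..<hi} then c i else 0)) ` ({lo..<hi} \<rightarrow>\<^sub>E K)
        \<subseteq> coeffs_in K lo hi"
      using assms(2) by (auto simp: coeffs_in_def PiE_iff)
  qed
  moreover have "finite ({lo..<hi} \<rightarrow>\<^sub>E K)" using assms(1) by (intro finite_PiE) auto
  ultimately show "finite (coeffs_in K lo hi)" "card (coeffs_in K lo hi) = card K ^ (hi - lo)"
    by (auto simp: bij_betw_finite bij_betw_same_card card_PiE)
qed

lemma coeffs_in_eqI:
  fixes f g :: "'a::ab_group_add fps"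
  assumes "f \<in> coeffs_in K lo hi" "g \<in> coeffs_in K lo hi" "vanishes hi (f - g)"
  shows "f = g"
proof (rule fps_ext)
  fix i show "fps_nth f i = fps_nth g i"
    using assms by (cases "i < hi") (auto simp: coeffs_in_def vanishes_def)
qed

definition cut :: "nat \<Rightarrow> nat \<Rightarrow> 'a::zero fps \<Rightarrow> 'a fps" where
  "cut lo hi f = Abs_fps (\<lambda>i. if lo \<le> i \<and> i < hi then fps_nth f i else 0)"

lemma cut_in: "0 \<in> K \<Longrightarrow> range (fps_nth f) \<subseteq> K \<Longrightarrow> cut lo hi f \<in> coeffs_in K lo hi"
  by (auto simp: cut_def coeffs_in_def)

lemma vanishes_cut:
  fixes f :: "'a::ab_group_add fps"
  assumes "\<And>i. i < lo \<Longrightarrow> fps_nth f i = 0"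
  shows "vanishes hi (f - cut lo hi f)"
  using assms by (auto simp: vanishes_def cut_def)

context
  fixes K :: "'a::field set"
  assumes K: "subfield_set K"
begin

lemma subfield_setD: "0 \<in> K" "1 \<in> K" "x \<in> K \<Longrightarrow> y \<in> K \<Longrightarrow> x + y \<in> K"
   "x \<in> K \<Longrightarrow> y \<in> K \<Longrightarrow> x * y \<in> K" "x \<in> K \<Longrightarrow> - x \<in> K" "x \<in> K \<Longrightarrow> inverse x \<in> K"
  using K by (auto simp: subfield_set_def)

lemma subfield_set_sum: "(\<And>i. i \<in> A \<Longrightarrow> f i \<in> K) \<Longrightarrow> sum f A \<in> K"
  by (induction A rule: infinite_finite_induct) (auto intro: subfield_setD)

lemma range_fps_mult: "range (fps_nth f) \<subseteq> K \<Longrightarrow> range (fps_nth g) \<subseteq> K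
    \<Longrightarrow> range (fps_nth (f * g)) \<subseteq> K"
  unfolding image_subset_iff fps_mult_nth by (auto intro!: subfield_set_sum subfield_setD)

lemma range_fps_add: "range (fps_nth f) \<subseteq> K \<Longrightarrow> range (fps_nth g) \<subseteq> K \<Longrightarrow> range (fps_nth (f + g)) \<subseteq> K"
  unfolding image_subset_iff by (auto intro!: subfield_setD)

lemma range_fps_uminus: "range (fps_nth f) \<subseteq> K \<Longrightarrow> range (fps_nth (- f)) \<subseteq> K"
  unfolding image_subset_iff by (auto intro!: subfield_setD)

lemma range_fps_const: "x \<in> K \<Longrightarrow> range (fps_nth (fps_const x)) \<subseteq> K"
  unfolding image_subset_iff by (auto intro!: subfield_setD)

lemma range_fps_one: "range (fps_nth 1) \<subseteq> K"
  using range_fps_const[OF subfield_setD(2)] by simp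

lemma range_fps_zero: "range (fps_nth 0) \<subseteq> K"
  using range_fps_const[OF subfield_setD(1)] by simp

lemma range_fps_X: "range (fps_nth fps_X) \<subseteq> K"
  unfolding image_subset_iff by (auto intro!: subfield_setD simp: fps_X_def)

text \<open>The recursion for the coefficients of the inverse uses only field operations.\<close>

lemma range_fps_inverse:
  assumes "range (fps_nth f) \<subseteq> K"
  shows "range (fps_nth (inverse f)) \<subseteq> K"
proof -
  have f: "fps_nth f i \<in> K" for i using assms by auto
  have "natfun_inverse f i \<in> K" for i
  proof (induction i rule: less_induct)
    case (less i)
    then show ?case
      by (cases i) (auto intro!: subfield_setD subfield_set_sum f simp del: sum.cl_ivl_Suc)
  qed
  then show ?thesis by (auto simp: fps_inverse_def)
qed

lemmas range_fps_intros = range_fps_mult range_fps_add range_fps_uminus range_fps_const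
  range_fps_one range_fps_zero range_fps_X range_fps_inverse

definition entries_in :: "'a fps mat2 \<Rightarrow> bool" where
  "entries_in A \<longleftrightarrow> range (fps_nth (m11 A)) \<subseteq> K \<and> range (fps_nth (m12 A)) \<subseteq> K \<and>
     range (fps_nth (m21 A)) \<subseteq> K \<and> range (fps_nth (m22 A)) \<subseteq> K"

lemma entries_in_mult: "entries_in A \<Longrightarrow> entries_in B \<Longrightarrow> entries_in (A * B)"
  unfolding entries_in_def mat2_sel by (intro conjI range_fps_intros) auto

lemma entries_in_adj2: "entries_in A \<Longrightarrow> entries_in (adj2 A)"
  unfolding entries_in_def adj2_sel by (intro conjI range_fps_intros) auto

lemma entries_in_upper: "s \<in> K \<Longrightarrow> entries_in (upper s)"
  and entries_in_lower: "s \<in> K \<Longrightarrow> entries_in (lower s)"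
  unfolding entries_in_def upper_sel lower_sel by (intro conjI range_fps_intros; assumption)+

end

text \<open>The fourth entry is the one that makes the determinant 1.\<close>

definition unip_mat :: "'a::field fps \<times> 'a fps \<times> 'a fps \<Rightarrow> 'a fps mat2" where
  "unip_mat = (\<lambda>(f, g, h). Mat2 (1 + f) g h ((1 + g * h) * inverse (1 + f)))"

lemma unip_mat:
  assumes "fps_nth f 0 = 0" "fps_nth h 0 = 0"
  shows "unip (unip_mat (f, g, h))"
proof -
  have "(1 + f) * inverse (1 + f) = 1" using assms by (intro inverse_mult_eq_1') simp
  then have "(1 + g * h) * ((1 + f) * inverse (1 + f)) = 1 + g * h" by (simp only: mult_1_right)
  then have "det2 (unip_mat (f, g, h)) = 1"
    unfolding unip_mat_def det2_def prod.case mat2.sel by (simp only: ac_simps add_diff_cancel)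
  then show ?thesis using assms by (simp add: unip_def unip_mat_def)
qed

lemma unip_mat_entries:
  assumes "subfield_set K" "f \<in> coeffs_in K i n" "g \<in> coeffs_in K i' n'" "h \<in> coeffs_in K i'' n''"
  shows "entries_in K (unip_mat (f, g, h))"
  unfolding unip_mat_def entries_in_def[OF assms(1)] prod.case mat2.sel using assms
  by (intro conjI range_fps_intros[OF assms(1)]) (auto simp: coeffs_in_def)

section \<open>Points, lines and double cosets\<close>

context truncation
begin

text \<open>The determinant fixes the product of the diagonal entries as 1 + m12 * m21, and m11 is a
  unit, so the fourth entry is controlled by the other three. The entry m12 is known only to order
  n', but m21 supplies another factor z.\<close>

lemma cong2_unip_mat:
  assumes A: "unip A" and c: "fps_nth f 0 = 0" "fps_nth h 0 = 0"
    and v: "vanishes n (m11 A - (1 + f))" "vanishes n' (m12 A - g)" "vanishes n (m21 A - h)"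
  shows "A \<doteq> unip_mat (f, g, h)"
proof -
  define B where "B = unip_mat (f, g, h)"
  have B: "unip B" "m11 B = 1 + f" "m12 B = g" "m21 B = h"
    using unip_mat c by (auto simp: B_def) (simp_all add: unip_mat_def)
  have "m11 A * m22 A = 1 + m12 A * m21 A" "m11 B * m22 B = 1 + m12 B * m21 B"
    using A B(1) by (auto simp: unip_def det2_def algebra_simps)
  then have "m11 B * (m22 A - m22 B) = (m12 A - m12 B) * m21 A + m12 B * (m21 A - m21 B)
      - (m11 A - m11 B) * m22 A"
    by (simp add: algebra_simps)
  moreover have "vanishes n ((m12 A - m12 B) * m21 A)"
    using v(2) A unfolding B by (intro vanishes_m12_times) (auto simp: unip_def)
  moreover have "vanishes n (m12 B * (m21 A - m21 B))" using v(3) unfolding B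
    by (rule vanishes_mult2)
  moreover have "vanishes n ((m11 A - m11 B) * m22 A)" using v(1) unfolding B
    by (rule vanishes_mult1)
  ultimately have "vanishes n (m11 B * (m22 A - m22 B))"
    by (simp only: vanishes_diff vanishes_add)
  then have "vanishes n (m22 A - m22 B)" by (rule vanishes_cancel) (use c in \<open>simp add: B\<close>)
  then show ?thesis using v B by (simp add: cong2_def small_def flip: B_def)
qed

lemma unip_mat_eqI:
  assumes "a \<in> coeffs_in K i n \<times> coeffs_in K i' n' \<times> coeffs_in K i'' n"
    "b \<in> coeffs_in K i n \<times> coeffs_in K i' n' \<times> coeffs_in K i'' n" "unip_mat a \<doteq> unip_mat b"
  shows "a = b"
  using assms by (auto simp: cong2_def small_def unip_mat_def intro: coeffs_in_eqI)

text \<open>Each double coset of the two subgroups contains a matrix without constant term at (1,2)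
  and without linear term at (2,1). Up to sign, \<open>flag_up\<close> and \<open>flag_low\<close>
  are the parameters of the letters that bring the quotient of the two matrices into this
  form.\<close>

definition flag_up :: "'a::field fps mat2 \<Rightarrow> 'a fps mat2 \<Rightarrow> 'a" where
  "flag_up A B = - fps_nth (m12 (A * adj2 B)) 0"

definition flag_low :: "'a::field fps mat2 \<Rightarrow> 'a fps mat2 \<Rightarrow> 'a" where
  "flag_low A B = fps_nth (m21 (upper (flag_up A B) * (A * adj2 B))) 1"

definition double_coset :: "'a::field fps mat2 \<Rightarrow> 'a fps mat2 \<Rightarrow> 'a fps mat2" where
  "double_coset A B = upper (flag_up A B) * (A * adj2 B) * lower (- flag_low A B)"

text \<open>The coefficients below the lower limits of the cuts are fixed by the normal form, so the
  triple determines the double coset.\<close>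

definition colour :: "'a::field fps mat2 \<Rightarrow> 'a fps mat2 \<Rightarrow> 'a fps \<times> 'a fps \<times> 'a fps" where
  "colour A B = (cut 1 n (m11 (double_coset A B)), cut 1 n' (m12 (double_coset A B)),
     cut 2 n (m21 (double_coset A B)))"

lemma colour_in:
  assumes K: "subfield_set K" and A: "entries_in K A" "entries_in K B"
  shows "colour A B \<in> coeffs_in K 1 n \<times> coeffs_in K 1 n' \<times> coeffs_in K 2 n"
proof -
  note e = entries_in_def[OF K]
  have AB: "entries_in K (A * adj2 B)" using A by (intro entries_in_mult entries_in_adj2 K)
  have "flag_up A B \<in> K" unfolding flag_up_def
    by (rule subfield_setD[OF K]) (use AB in \<open>unfold e, blast\<close>)
  then have up: "entries_in K (upper (flag_up A B) * (A * adj2 B))"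
    by (intro entries_in_mult entries_in_upper K AB)
  then have "flag_low A B \<in> K" unfolding e flag_low_def by blast
  then have "entries_in K (double_coset A B)" unfolding double_coset_def
    by (intro entries_in_mult entries_in_lower K up subfield_setD)
  then show ?thesis using subfield_setD(1)[OF K] by (simp add: colour_def e cut_in)
qed

text \<open>An edge singles out one element in the coset of its point and one in the coset of its
  line, and these differ by a matrix that depends only on the colour.\<close>

lemma colour_cong:
  fixes A B :: "'a::field fps mat2"
  assumes A: "unip A" and B: "unip B"
  shows "upper (flag_up A B) * A \<doteq> unip_mat (colour A B) * lower (flag_low A B) * B"
proof -
  define Y where "Y = A * adj2 B"
  define D where "D = double_coset A B"
  have Y: "unip Y" using A B by (simp add: Y_def unip_mult unip_adj2)
  have D: "D = upper (flag_up A B) * Y * lower (- flag_low A B)"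
    by (simp add: D_def Y_def double_coset_def)
  have UY: "unip (upper (flag_up A B) * Y)" using Y by (simp add: unip_mult)
  have uD: "unip D" using UY by (simp add: D unip_mult)
  have "fps_nth (m12 D) 0 = 0"
    using unip_m22[OF Y] by (simp add: D flag_up_def Y_def[symmetric])
  moreover have "fps_nth (m21 D) 1 = 0"
  proof -
    have "m21 D = m21 (upper (flag_up A B) * Y) + m22 (upper (flag_up A B) * Y) * (fps_const
        (- flag_low A B) * fps_X)"
      unfolding D mat2_sel lower_sel by simp
    then have "fps_nth (m21 D) 1 = flag_low A B + fps_nth (m22 (upper (flag_up A B) * Y)) 0 *
        (- flag_low A B)"
      by (simp add: flag_low_def Y_def fps_mult_nth_1)
    then show ?thesis using unip_m22[OF UY] by simp
  qed
  moreover have "fps_nth (m11 D) 0 = 1" "fps_nth (m21 D) 0 = 0" using uD by (auto simp: unip_def)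
  ultimately have nth: "fps_nth (m12 D) 0 = 0" "fps_nth (m21 D) 0 = 0"
      "fps_nth (m21 D) 1 = 0" "fps_nth (m11 D) 0 = 1"
    by auto
  have "D \<doteq> unip_mat (colour A B)"
    unfolding colour_def D_def[symmetric]
  proof (rule cong2_unip_mat[OF uD])
    show "vanishes n (m11 D - (1 + cut 1 n (m11 D)))"
      using nth by (auto simp: vanishes_def cut_def Suc_le_eq)
    show "vanishes n' (m12 D - cut 1 n' (m12 D))" by (rule vanishes_cut) (simp add: nth)
    show "vanishes n (m21 D - cut 2 n (m21 D))"
      by (rule vanishes_cut) (use nth in \<open>auto simp: less_2_cases_iff\<close>)
  qed (auto simp: cut_def)
  then have "D * (lower (flag_low A B) * B) \<doteq> unip_mat (colour A B) * (lower (flag_low A B) * B)"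
    by (rule cong2_mult_right) (simp add: unip_mult B)
  also have "D * (lower (flag_low A B) * B) = upper (flag_up A B) * A * (adj2 B * (lower
      (- flag_low A B) * lower (flag_low A B)) * B)"
    unfolding D Y_def by (simp add: mult.assoc)
  finally show ?thesis by (simp add: unip_inverse B mult.assoc flip: lower_add)
qed

text \<open>A point is a coset, represented by its element without constant term at (1,2).
  Multiplication by \<open>upper s\<close> makes this term s, and it survives truncation as n' >= 1,
  so s can be read off and cancelled.\<close>

lemma point_eqI:
  assumes a: "a \<in> coeffs_in K 1 n \<times> coeffs_in K 1 n' \<times> coeffs_in K 1 n"
    "b \<in> coeffs_in K 1 n \<times> coeffs_in K 1 n' \<times> coeffs_in K 1 n"
    and eq: "upper s * unip_mat a \<doteq> upper t * unip_mat b" and "n' \<ge> 1"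
  shows "a = b"
proof -
  have u: "unip (unip_mat a)" "unip (unip_mat b)"
    using a by (auto intro!: unip_mat simp: coeffs_in_def)
  have "vanishes n' (m12 (upper s * unip_mat a - upper t * unip_mat b))"
    using eq by (simp add: cong2_def small_def)
  then have "fps_nth (m12 (upper s * unip_mat a - upper t * unip_mat b)) 0 = 0"
    by (rule vanishes_nth) (use assms in simp)
  moreover have "fps_nth (m12 (unip_mat a)) 0 = 0" "fps_nth (m12 (unip_mat b)) 0 = 0"
    using a by (auto simp: unip_mat_def coeffs_in_def)
  ultimately have "s = t" using unip_m22[OF u(1)] unip_m22[OF u(2)] by simp
  then have "unip_mat a \<doteq> unip_mat b" using eq by (auto intro: cong2_cancel_left)
  then show ?thesis by (rule unip_mat_eqI[OF a])
qed

text \<open>As for points, with the linear term at (2,1), which survives truncation as n >=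
  2.\<close>

lemma line_eqI:
  assumes a: "a \<in> coeffs_in K 1 n \<times> coeffs_in K 0 n' \<times> coeffs_in K 2 n"
    "b \<in> coeffs_in K 1 n \<times> coeffs_in K 0 n' \<times> coeffs_in K 2 n"
    and eq: "lower s * unip_mat a \<doteq> lower t * unip_mat b" and "n \<ge> 2"
  shows "a = b"
proof -
  have "vanishes n (m21 (lower s * unip_mat a - lower t * unip_mat b))"
    using eq by (simp add: cong2_def small_def)
  then have "fps_nth (m21 (lower s * unip_mat a - lower t * unip_mat b)) 1 = 0"
    by (rule vanishes_nth) (use assms in simp)
  moreover have "fps_nth (m21 (unip_mat a)) 1 = 0" "fps_nth (m21 (unip_mat b)) 1 = 0"
    "fps_nth (m11 (unip_mat a)) 0 = 1" "fps_nth (m11 (unip_mat b)) 0 = 1"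
    using a by (auto simp: unip_mat_def coeffs_in_def)
  ultimately have "s = t" by (simp add: mult.assoc)
  then have "unip_mat a \<doteq> unip_mat b" using eq by (auto intro: cong2_cancel_left)
  then show ?thesis by (rule unip_mat_eqI[OF a])
qed

text \<open>\<open>F j\<close> is the element that edge j singles out in the coset of its point.
  Consecutive edges share a line or a point, so \<open>F\<close> changes by a conjugated letter or
  by a letter of \<open>upper\<close>, respectively. A zero parameter would mean that the walk turns
  back.\<close>

lemma no_monochromatic_walk:
  fixes K :: "'a::field set" and p :: "nat \<Rightarrow> 'a fps \<times> 'a fps \<times> 'a fps"
  assumes k: "k \<ge> 2" "n = k div 2 + 1" "n' = Suc k div 2"
    and pts: "\<And>j. even j \<Longrightarrow> p j \<in> coeffs_in K 1 n \<times> coeffs_in K 1 n' \<times> coeffs_in K 1 n"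
    and lns: "\<And>j. odd j \<Longrightarrow> p j \<in> coeffs_in K 1 n \<times> coeffs_in K 0 n' \<times> coeffs_in K 2 n"
    and period: "\<And>j. p (j + 2 * k) = p j" and nb: "\<And>j. p (j + 2) \<noteq> p j"
    and mono: "\<And>j. (if even j then colour (unip_mat (p j)) (unip_mat (p (Suc j)))
       else colour (unip_mat (p (Suc j))) (unip_mat (p j))) = c"
  shows False
proof -
  have nn: "n' \<ge> 1" "n \<ge> 2" using k by auto
  define M where "M j = unip_mat (p j)" for j
  have M: "unip (M j)" for j
    using pts[of j] lns[of j] unfolding M_def
    by (cases "even j") (auto intro!: unip_mat simp: coeffs_in_def)
  \<comment> \<open>Edge j has the point \<open>p (u j)\<close> and the line \<open>p (w j)\<close>
    as its ends.\<close>
  define u where "u j = (if even j then j else Suc j)" for j :: nat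
  define w where "w j = (if even j then Suc j else j)" for j :: nat
  define s where "s j = flag_up (M (u j)) (M (w j))" for j
  define t where "t j = flag_low (M (u j)) (M (w j))" for j
  define x where "x = unip_mat c"
  define F where "F j = upper (s j) * M (u j)" for j
  have c: "colour (M (u j)) (M (w j)) = c" for j
    using mono[of j] by (auto simp: M_def u_def w_def)
  have x: "unip x"
    unfolding x_def c[of 0, symmetric] colour_def by (rule unip_mat) (auto simp: cut_def)
  have F: "F j \<doteq> x * lower (t j) * M (w j)" for j
    using colour_cong[OF M M, of "u j" "w j"] by (simp only: F_def s_def t_def x_def c)
  have uF: "unip (F j)" for j by (simp add: F_def unip_mult M)
  \<comment> \<open>The edges j and j + 1 share a line if j is even and a point if j is odd.\<close>
  define r where "r j = (if odd j then s (Suc j) - s j else t (Suc j) - t j)" for j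
  show False
  proof (rule no_closed_walk[OF x uF, where e = odd and s = r and k = k])
    show "r j \<noteq> 0" for j
    proof (cases "even j")
      case True
      have w: "w (Suc j) = w j" and u: "u j = j" "u (Suc j) = j + 2" using True
        by (auto simp: w_def u_def)
      have "t (Suc j) \<noteq> t j"
      proof
        assume "t (Suc j) = t j"
        then have "F (Suc j) \<doteq> F j"
          using F[of "Suc j"] F[of j] w by (auto intro: cong2_trans cong2_sym)
        then have "upper (s (Suc j)) * unip_mat (p (j + 2)) \<doteq> upper (s j) * unip_mat (p j)"
          by (simp only: F_def M_def u)
        then have "p (j + 2) = p j"
          by (rule point_eqI[rotated 2, OF _ nn(1) pts pts]) (use True in auto)
        then show False using nb by blast
      qed
      then show ?thesis using True by (simp add: r_def)
    next
      case False
      have u: "u (Suc j) = u j" and w: "w j = j" "w (Suc j) = j + 2" using False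
        by (auto simp: w_def u_def)
      have "s (Suc j) \<noteq> s j"
      proof
        assume "s (Suc j) = s j"
        then have "F (Suc j) = F j" by (simp add: F_def u)
        then have "x * (lower (t (Suc j)) * M (j + 2)) \<doteq> x * (lower (t j) * M j)"
          using F[of "Suc j"] F[of j] w by (auto simp: mult.assoc intro: cong2_trans cong2_sym)
        then have "lower (t (Suc j)) * M (j + 2) \<doteq> lower (t j) * M j"
          by (rule cong2_cancel_left) (rule x)
        then have "p (j + 2) = p j"
          unfolding M_def by (rule line_eqI[rotated 2, OF _ nn(2) lns lns]) (use False in auto)
        then show False using nb by blast
      qed
      then show ?thesis using False by (simp add: r_def)
    qed
    show "F (Suc j) \<doteq> (if odd j then upper (r j) else x * lower (r j) * adj2 x) * F j" for j
    proof (cases "even j")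
      case True
      have w: "w (Suc j) = w j" using True by (auto simp: w_def)
      have "x * lower (r j) * adj2 x * F j \<doteq> x * lower (r j) * adj2 x * (x * lower (t j) * M
          (w j))"
        by (rule cong2_mult_left[OF F]) (intro unip_mult unip_adj2 unip_lower x)
      also have "\<dots> = x * lower (r j) * (adj2 x * x) * lower (t j) * M (w j)"
        by (simp only: mult.assoc)
      also have "\<dots> = x * (lower (r j) * lower (t j)) * M (w j)"
        by (simp add: unip_inverse x mult.assoc)
      also have "lower (r j) * lower (t j) = lower (t (Suc j))"
        using True by (simp add: r_def flip: lower_add)
      also have "x * lower (t (Suc j)) * M (w j) \<doteq> F (Suc j)" using F[of "Suc j"] w
        by (auto intro: cong2_sym)
      finally show ?thesis using True by (auto intro: cong2_sym)
    next
      case False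
      have "u (Suc j) = u j" using False by (auto simp: u_def)
      moreover have "upper (r j) * upper (s j) = upper (s (Suc j))"
        using False by (simp add: r_def flip: upper_add)
      ultimately have "F (Suc j) = upper (r j) * F j" by (simp add: F_def flip: mult.assoc)
      then show ?thesis using False by simp
    qed
    have "p (2 * k) = p 0" "p (Suc (2 * k)) = p 1" using period[of 0] period[of 1] by auto
    then show "F (2 * k) = F 0" by (simp add: F_def s_def u_def w_def M_def)
  qed (use k in auto)
qed

end

text \<open>Points, lines and colours are numbered, which frees the graph theory below from matrices
  and fields.\<close>

theorem walk_free_colouring:
  fixes k m :: nat
  assumes k: "k \<ge> 2" and m: "m \<ge> 1"
  defines "E \<equiv> k + k div 2" and "q \<equiv> 2 ^ m"
  shows "\<exists>\<kappa> :: nat \<Rightarrow> nat \<Rightarrow> nat.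
    (\<forall>i < q ^ (E - 1). \<forall>j < q ^ (E - 1). \<kappa> i j < q ^ (E - 2)) \<and>
    (\<nexists>p c. (\<forall>j. p j < q ^ (E - 1)) \<and> (\<forall>j. p (j + 2 * k) = p j) \<and> (\<forall>j. p (j + 2) \<noteq> p j) \<and>
       (\<forall>j. (if even j then \<kappa> (p j) (p (Suc j)) else \<kappa> (p (Suc j)) (p j)) = c))"
proof -
  obtain K :: "bit alg_closure set" where K: "subfield_set K" "finite K" "card K = q"
    using finite_subfield_bit_closure[OF m] unfolding q_def by blast
  have K0: "0 \<in> K" using K by (simp add: subfield_set_def)
  define n where "n = k div 2 + 1"
  define n' where "n' = Suc k div 2"
  interpret truncation n n' by standard (auto simp: n_def n'_def)
  define P where "P = coeffs_in K 1 n \<times> coeffs_in K 1 n' \<times> coeffs_in K 1 n"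
  define L where "L = coeffs_in K 1 n \<times> coeffs_in K 0 n' \<times> coeffs_in K 2 n"
  define C where "C = coeffs_in K 1 n \<times> coeffs_in K 1 n' \<times> coeffs_in K 2 n"
  have fin: "finite P" "finite L" "finite C"
    using coeffs_in_card(1)[OF K(2) K0] by (auto simp: P_def L_def C_def)
  \<comment> \<open>These are the numbers of free coefficients of a point, a line and a colour. Each
    normalisation by a subgroup of order q removes one from the exponent \<open>E\<close> of the
    group order.\<close>
  have nn: "n - 1 + (n' - 1 + (n - 1)) = E - 1" "n - 1 + (n' + (n - 2)) = E - 1"
    "n - 1 + (n' - 1 + (n - 2)) = E - 2"
    using k by (auto simp: n_def n'_def E_def)
  have card: "card P = q ^ (E - 1)" "card L = q ^ (E - 1)" "card C = q ^ (E - 2)"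
    unfolding P_def L_def C_def card_cartesian_product coeffs_in_card(2)[OF K(2) K0] K(3)
    by (simp_all only: diff_zero nn flip: power_add)
  define N where "N = q ^ (E - 1)"
  obtain f g where f: "bij_betw f {..<N} P" and g: "bij_betw g {..<N} L"
    using fin card by (metis N_def bij_betw_iff_card finite_lessThan card_lessThan)
  obtain h where h: "bij_betw h C {..<q ^ (E - 2)}"
    using fin card by (metis bij_betw_iff_card finite_lessThan card_lessThan)
  have fP: "f i \<in> P" "g i \<in> L" if "i < N" for i using f g that by (auto simp: bij_betw_def)
  define \<kappa> where "\<kappa> i j = h (colour (unip_mat (f i)) (unip_mat (g j)))" for i j
  have col: "colour (unip_mat (f i)) (unip_mat (g j)) \<in> C" if "i < N" "j < N" for i j
    using fP(1)[OF that(1)] fP(2)[OF that(2)] unfolding P_def L_def C_def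
    by (intro colour_in[OF K(1)]) (auto intro!: unip_mat_entries[OF K(1)])
  have 1: "\<kappa> i j < q ^ (E - 2)" if "i < N" "j < N" for i j
    using col[OF that] h by (auto simp: \<kappa>_def bij_betw_def)
  have 2: False if p: "\<And>j. p j < N" "\<And>j. p (j + 2 * k) = p j" "\<And>j. p (j + 2) \<noteq> p j"
    "\<And>j. (if even j then \<kappa> (p j) (p (Suc j)) else \<kappa> (p (Suc j)) (p j)) = c" for p c
  proof -
    define p' where "p' j = (if even j then f (p j) else g (p j))" for j
    have "inj_on f {..<N}" "inj_on g {..<N}" "inj_on h C" using f g h by (auto simp: bij_betw_def)
    note inj = this[THEN inj_onD]
    define col' where "col' j = (if even j then colour (unip_mat (p' j)) (unip_mat (p' (Suc j)))
       else colour (unip_mat (p' (Suc j))) (unip_mat (p' j)))" for j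
    have c: "col' j \<in> C" "h (col' j) = c" for j
      using col[OF p(1) p(1), of j "Suc j"] col[OF p(1) p(1), of "Suc j" j] p(4)[of j]
      by (auto simp: col'_def p'_def \<kappa>_def)
    have c': "col' j = col' 0" for j by (rule inj(3)) (auto simp: c)
    show False
    proof (rule no_monochromatic_walk[OF k n_def n'_def, where p = p' and K = K and c = "col' 0"])
      show "p' (j + 2) \<noteq> p' j" for j
        using inj(1)[of "p (j + 2)" "p j"] inj(2)[of "p (j + 2)" "p j"] p(1,3)
        by (auto simp: p'_def)
      show "(if even j then colour (unip_mat (p' j)) (unip_mat (p' (Suc j)))
        else colour (unip_mat (p' (Suc j))) (unip_mat (p' j))) = col' 0" for j
        using c'[of j] by (simp only: col'_def)
    qed (use fP p in \<open>auto simp: p'_def P_def L_def\<close>)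
  qed
  show ?thesis using 1 2 unfolding N_def by (intro exI[of _ \<kappa>]) blast
qed

subsection \<open>Colourings without closed walks\<close>

text \<open>Closed walks are periodic sequences, so turning back is excluded at the closing point as
  well. Nonbacktracking walks replace cycles because they are preserved by locally injective maps,
  which may identify distant vertices.\<close>

definition walk_colourable :: "nat \<Rightarrow> 'a set set \<Rightarrow> nat \<Rightarrow> bool" where
  "walk_colourable k E s \<longleftrightarrow> (\<exists>c :: 'a set \<Rightarrow> nat. c ` E \<subseteq> {..<s} \<and>
     (\<nexists>p i. (\<forall>j. p (j + 2 * k) = p j) \<and> (\<forall>j. p (j + 2) \<noteq> p j) \<and>
        (\<forall>j. {p j, p (Suc j)} \<in> E \<and> c {p j, p (Suc j)} = i)))"

lemma walk_colourable_mono: "walk_colourable k E s \<Longrightarrow> s \<le> t \<Longrightarrow> walk_colourable k E t"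
  unfolding walk_colourable_def by (meson lessThan_subset_iff order_trans)

lemma walk_colourable_empty: "walk_colourable k {} s"
  by (auto simp: walk_colourable_def)

lemma walk_colourable_Un:
  assumes "walk_colourable k E s" "walk_colourable k E' t"
  shows "walk_colourable k (E \<union> E') (s + t)"
proof -
  obtain c where c: "c ` E \<subseteq> {..<s}"
    "\<nexists>p i. (\<forall>j. p (j + 2 * k) = p j) \<and> (\<forall>j. p (j + 2) \<noteq> p j) \<and>
        (\<forall>j. {p j, p (Suc j)} \<in> E \<and> c {p j, p (Suc j)} = i)"
    using assms(1) by (auto simp: walk_colourable_def)
  obtain c' where c': "c' ` E' \<subseteq> {..<t}"
    "\<nexists>p i. (\<forall>j. p (j + 2 * k) = p j) \<and> (\<forall>j. p (j + 2) \<noteq> p j) \<and>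
        (\<forall>j. {p j, p (Suc j)} \<in> E' \<and> c' {p j, p (Suc j)} = i)"
    using assms(2) by (auto simp: walk_colourable_def)
  define d where "d e = (if e \<in> E then c e else s + c' e)" for e
  have "d ` (E \<union> E') \<subseteq> {..<s + t}" using c(1) c'(1) by (force simp: d_def image_subset_iff)
  moreover have False
    if p: "\<And>j. p (j + 2 * k) = p j" "\<And>j. p (j + 2) \<noteq> p j"
      "\<And>j. {p j, p (Suc j)} \<in> E \<union> E'" "\<And>j. d {p j, p (Suc j)} = i" for p i
  proof (cases "i < s")
    case True
    then have "{p j, p (Suc j)} \<in> E \<and> c {p j, p (Suc j)} = i" for j
      using p(3,4)[of j] by (auto simp: d_def split: if_splits)
    then show False using c(2) p(1,2) by blast
  next
    case False
    then have "{p j, p (Suc j)} \<in> E' \<and> c' {p j, p (Suc j)} = i - s" for j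
      using p(3,4)[of j] c(1) by (auto simp: d_def image_subset_iff split: if_splits)
    then show False using c'(2) p(1,2) by blast
  qed
  ultimately show ?thesis unfolding walk_colourable_def by (intro exI[of _ d]) blast
qed

section \<open>Maximum cuts and bipartite graphs\<close>

definition crossing :: "'a set \<Rightarrow> 'a set \<Rightarrow> bool" where
  "crossing A e \<longleftrightarrow> e \<inter> A \<noteq> {} \<and> e - A \<noteq> {}"

text \<open>In a cut with the most crossing edges, moving v to the other side exchanges the cut and
  the uncut edges at v, so the uncut ones cannot be in the majority.\<close>

lemma max_cut:
  assumes fin: "finite E" and two: "\<And>e. e \<in> E \<Longrightarrow> card e = 2"
  obtains A where "\<And>v. 2 * card {e \<in> E. v \<in> e \<and> \<not> crossing A e} \<le> card {e \<in> E. v \<in> e}"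
proof -
  define \<phi> where "\<phi> A = card {e \<in> E. crossing A e}" for A
  have "\<phi> A < card E + 1" for A
    using card_mono[of E "{e \<in> E. crossing A e}"] fin by (auto simp: \<phi>_def less_Suc_eq_le)
  then obtain A where A: "\<And>B. \<phi> B \<le> \<phi> A"
    using ex_has_greatest_nat[of "\<lambda>_. True" _ \<phi> "card E + 1"] by auto
  show ?thesis
  proof (rule that[of A])
    fix v
    define B where "B = (if v \<in> A then A - {v} else insert v A)"
    define S where "S = {e \<in> E. v \<in> e}"
    have finS: "finite S" using fin by (simp add: S_def)
    have flip: "crossing B e \<longleftrightarrow> \<not> crossing A e" if e: "e \<in> S" for e
    proof -
      obtain w where "e = {v, w}" "w \<noteq> v"
        using e two[of e] by (auto simp: S_def card_2_iff)
      then show ?thesis by (auto simp: crossing_def B_def)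
    qed
    have same: "crossing B e \<longleftrightarrow> crossing A e" if "v \<notin> e" for e
      using that by (auto simp: crossing_def B_def)
    define R where "R = {e \<in> E. v \<notin> e \<and> crossing A e}"
    have split: "\<phi> D = card {e \<in> E. v \<notin> e \<and> crossing D e} + card {e \<in> S. crossing D e}" for D
    proof -
      have "{e \<in> E. crossing D e} = {e \<in> E. v \<notin> e \<and> crossing D e} \<union> {e \<in> S. crossing D e}"
        by (auto simp: S_def)
      then show ?thesis unfolding \<phi>_def
        by (simp only:) (rule card_Un_disjoint, use fin finS in \<open>auto simp: S_def\<close>)
    qed
    have "\<phi> A = card R + card {e \<in> S. crossing A e}" unfolding R_def by (rule split)
    moreover have "\<phi> B = card R + card {e \<in> S. \<not> crossing A e}"
    proof -
      have "{e \<in> E. v \<notin> e \<and> crossing B e} = R" using same by (auto simp: R_def)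
      moreover have "{e \<in> S. crossing B e} = {e \<in> S. \<not> crossing A e}" using flip by blast
      ultimately show ?thesis using split[of B] by simp
    qed
    ultimately have 1: "card {e \<in> S. \<not> crossing A e} \<le> card {e \<in> S. crossing A e}" using A[of B]
      by linarith
    have "S = {e \<in> S. \<not> crossing A e} \<union> {e \<in> S. crossing A e}" by blast
    then have "card S = card {e \<in> S. \<not> crossing A e} + card {e \<in> S. crossing A e}"
      using finS by (subst card_Un_disjoint[symmetric]) auto
    moreover have "{e \<in> S. \<not> crossing A e} = {e \<in> E. v \<in> e \<and> \<not> crossing A e}"
      by (auto simp: S_def)
    ultimately show "2 * card {e \<in> E. v \<in> e \<and> \<not> crossing A e} \<le> card {e \<in> E. v \<in> e}"
      using 1 by (simp add: S_def)
  qed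
qed

text \<open>A colour is a pair of the value of \<open>\<kappa>\<close> at the labels of the ends and
  a second colour, which separates edges at a common vertex whose other ends have equal labels.
  Along a monochromatic walk the labels then form a nonbacktracking walk for
  \<open>\<kappa>\<close>.\<close>

lemma walk_colourable_bipartite:
  fixes E :: "'a set set" and \<kappa> :: "nat \<Rightarrow> nat \<Rightarrow> nat"
  assumes fin: "finite E" and two: "\<And>e. e \<in> E \<Longrightarrow> card e = 2" and cr: "\<And>e. e \<in> E \<Longrightarrow> crossing A e"
    and deg: "\<And>v. card {e \<in> E. v \<in> e} \<le> N" and N: "N \<ge> 1" and L: "4 * N ^ 3 \<le> fact L"
    and \<kappa>: "\<And>i j. i < N \<Longrightarrow> j < N \<Longrightarrow> \<kappa> i j < r"
    and nowalk: "\<nexists>p c. (\<forall>j. p j < N) \<and> (\<forall>j. p (j + 2 * k) = p j) \<and> (\<forall>j. p (j + 2) \<noteq> p j) \<and>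
       (\<forall>j. (if even j then \<kappa> (p j) (p (Suc j)) else \<kappa> (p (Suc j)) (p j)) = c)"
  shows "walk_colourable k E (r * (2 * L))"
proof -
  define V where "V = \<Union>E"
  have "finite e" if "e \<in> E" for e using two[OF that] by (intro card_ge_0_finite) simp
  then have finV: "finite V" unfolding V_def using fin by blast
  define Nb where "Nb u = {w. {u, w} \<in> E}" for u
  have ne: "u \<noteq> w" if "{u, w} \<in> E" for u w using two[OF that] by auto
  have Nb_deg: "card (Nb u) \<le> N" for u
  proof -
    have "inj_on (\<lambda>w. {u, w}) (Nb u)" by (auto intro!: inj_onI simp: doubleton_eq_iff)
    then have "card (Nb u) \<le> card {e \<in> E. u \<in> e}"
      by (rule card_inj_on_le) (use fin in \<open>auto simp: Nb_def\<close>)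
    then show ?thesis using deg[of u] by simp
  qed
  have NbV: "Nb u \<subseteq> V" for u by (auto simp: Nb_def V_def)
  then have finNb: "finite (Nb u)" for u using finV finite_subset by blast
  have symNb: "w \<in> Nb u \<longleftrightarrow> u \<in> Nb w" for u w by (simp add: Nb_def insert_commute)
  obtain f :: "'a \<Rightarrow> nat" where f: "\<And>u. u \<in> V \<Longrightarrow> f u < N"
    and frugal: "\<And>u c. u \<in> V \<Longrightarrow> card {w \<in> Nb u. f w = c} < L"
    by (rule frugal_labelling[where V = V and Nb = Nb, OF finV NbV symNb Nb_deg N L]) blast
  \<comment> \<open>By frugality an edge is in conflict with fewer than L edges at each of its ends,
    itself included, so 2L second colours suffice.\<close>
  define R where "R e e' \<longleftrightarrow> (\<exists>u w w'. e = {u, w} \<and> e' = {u, w'} \<and> f w = f w')" for e e'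
  have symR: "R e e' \<Longrightarrow> R e' e" for e e' unfolding R_def by metis
  have degR: "card {e' \<in> E. R e e'} < 2 * L" if e: "e \<in> E" for e
  proof -
    obtain u w where uw: "e = {u, w}" "u \<noteq> w" using two[OF e] by (auto simp: card_2_iff)
    have uV: "u \<in> V" "w \<in> V" using e uw by (auto simp: V_def)
    define Su where "Su = {w' \<in> Nb u. f w' = f w}"
    define Sw where "Sw = {u' \<in> Nb w. f u' = f u}"
    have finS: "finite Su" "finite Sw" using finNb by (auto simp: Su_def Sw_def)
    have "{e' \<in> E. R e e'} \<subseteq> (\<lambda>w'. {u, w'}) ` Su \<union> (\<lambda>u'. {w, u'}) ` Sw"
      using uw by (auto simp: R_def Su_def Sw_def Nb_def doubleton_eq_iff)
    then have "card {e' \<in> E. R e e'} \<le> card ((\<lambda>w'. {u, w'}) ` Su \<union> (\<lambda>u'. {w, u'}) ` Sw)"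
      using finS by (intro card_mono) auto
    also have "\<dots> \<le> card ((\<lambda>w'. {u, w'}) ` Su) + card ((\<lambda>u'. {w, u'}) ` Sw)" by (rule card_Un_le)
    also have "\<dots> \<le> card Su + card Sw" by (intro add_mono card_image_le finS)
    also have "\<dots> < 2 * L" using frugal[OF uV(1), of "f w"] frugal[OF uV(2), of "f u"]
      by (simp add: Su_def Sw_def)
    finally show ?thesis .
  qed
  have "\<exists>g :: 'a set \<Rightarrow> nat. g ` E \<subseteq> {..<2 * L} \<and>
      (\<forall>e\<in>E. \<forall>e'\<in>E. e \<noteq> e' \<longrightarrow> R e e' \<longrightarrow> g e \<noteq> g e')"
    by (rule greedy_colouring) (fact fin symR degR)+
  then obtain g :: "'a set \<Rightarrow> nat" where g: "g ` E \<subseteq> {..<2 * L}"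
    and g_ne': "\<forall>e\<in>E. \<forall>e'\<in>E. e \<noteq> e' \<longrightarrow> R e e' \<longrightarrow> g e \<noteq> g e'"
    by auto
  have g_ne: "g e \<noteq> g e'" if "e \<in> E" "e' \<in> E" "e \<noteq> e'" "R e e'" for e e'
    using g_ne' that by blast
  define h where "h e = \<kappa> (f (SOME a. a \<in> e \<inter> A)) (f (SOME b. b \<in> e - A))" for e
  have h: "h {a, b} = \<kappa> (f a) (f b)" if "a \<in> A" "b \<notin> A" for a b
  proof -
    have "{a, b} \<inter> A = {a}" "{a, b} - A = {b}" using that by auto
    then show ?thesis by (simp add: h_def)
  qed
  have edge: "\<exists>a b. e = {a, b} \<and> a \<in> A \<and> b \<notin> A" if e: "e \<in> E" for e
  proof -
    obtain u w where "e = {u, w}" using two[OF e] by (auto simp: card_2_iff)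
    then show ?thesis using cr[OF e] by (auto simp: crossing_def insert_commute)
  qed
  have hr: "h e < r" if "e \<in> E" for e
  proof -
    obtain a b where ab: "e = {a, b}" "a \<in> A" "b \<notin> A" using edge[OF \<open>e \<in> E\<close>] by blast
    then have "a \<in> V" "b \<in> V" using \<open>e \<in> E\<close> by (auto simp: V_def)
    then show ?thesis using ab h f \<kappa> by simp
  qed
  \<comment> \<open>The pair is encoded as one number, with the second colour as remainder modulo
    2L.\<close>
  define c where "c e = h e * (2 * L) + g e" for e
  have gL: "g e < 2 * L" if "e \<in> E" for e using g that by auto
  have c_eq: "h e = h e' \<and> g e = g e'" if "e \<in> E" "e' \<in> E" "c e = c e'" for e e'
  proof -
    have "h e = c e div (2 * L)" "g e = c e mod (2 * L)" if "e \<in> E" for e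
      using gL[OF that] by (simp_all add: c_def)
    then show ?thesis using that by simp
  qed
  have "c ` E \<subseteq> {..<r * (2 * L)}"
  proof clarify
    fix e assume e: "e \<in> E"
    have "c e < (h e + 1) * (2 * L)" using gL[OF e] by (simp add: c_def)
    also have "\<dots> \<le> r * (2 * L)" using hr[OF e] by (intro mult_le_mono1) simp
    finally show "c e < r * (2 * L)" .
  qed
  moreover have False
    if p: "\<And>j. p (j + 2 * k) = p j" "\<And>j. p (j + 2) \<noteq> p j"
      "\<And>j. {p j, p (Suc j)} \<in> E" "\<And>j. c {p j, p (Suc j)} = i" for p i
  proof -
    have alt: "p (Suc j) \<in> A \<longleftrightarrow> p j \<notin> A" for j
      using cr[OF p(3)[of j]] by (auto simp: crossing_def)
    \<comment> \<open>\<open>\<kappa>\<close> takes the label on the side \<open>A\<close> first. A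
      walk that starts on the other side is shifted by one position.\<close>
    have fin_case: False
      if p: "\<And>j. p (j + 2 * k) = p j" "\<And>j. p (j + 2) \<noteq> p j"
      "\<And>j. {p j, p (Suc j)} \<in> E" "\<And>j. c {p j, p (Suc j)} = i" and p0: "p 0 \<in> A"
      and alt: "\<And>j. p (Suc j) \<in> A \<longleftrightarrow> p j \<notin> A" for p
    proof -
      have par: "p j \<in> A \<longleftrightarrow> even j" for j by (induction j) (auto simp: p0 alt)
      have pV: "p j \<in> V" for j using p(3)[of j] by (auto simp: V_def)
      have fne: "f (p (j + 2)) \<noteq> f (p j)" for j
      proof
        assume eq: "f (p (j + 2)) = f (p j)"
        have R: "R {p j, p (Suc j)} {p (Suc j), p (Suc (Suc j))}"
          unfolding R_def using eq
          by (intro exI[of _ "p (Suc j)"] exI[of _ "p j"] exI[of _ "p (Suc (Suc j))"])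
              (simp add: insert_commute)
        have "{p j, p (Suc j)} \<noteq> {p (Suc j), p (Suc (Suc j))}"
          using p(2)[of j] ne[OF p(3)[of j]] by (auto simp: doubleton_eq_iff)
        from g_ne[OF p(3) p(3) this R] show False
          using c_eq[OF p(3) p(3), of j "Suc j"] p(4) by simp
      qed
      have \<kappa>h: "(if even j then \<kappa> (f (p j)) (f (p (Suc j))) else \<kappa> (f (p (Suc j))) (f (p j)))
          = h {p j, p (Suc j)}" for j
        using h[of "p j" "p (Suc j)"] h[of "p (Suc j)" "p j"] par[of j] par[of "Suc j"]
        by (auto simp: insert_commute)
      have hc: "h {p j, p (Suc j)} = h {p 0, p (Suc 0)}" for j
        using c_eq[OF p(3) p(3), of j 0] p(4) by simp
      show False
        by (rule notE[OF nowalk], intro exI[of _ "\<lambda>j. f (p j)"] exI[of _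
            "h {p 0, p (Suc 0)}"] conjI allI)
          (rule f pV | (simp only: p(1)) | rule fne | (subst \<kappa>h, rule hc))+
    qed
    show False
    proof (cases "p 0 \<in> A")
      case True
      then show False by (intro fin_case[of p] p alt)
    next
      case False
      have "p (Suc (j + 2 * k)) = p (Suc j)" "p (Suc (j + 2)) \<noteq> p (Suc j)" for j
        using p(1)[of "Suc j"] p(2)[of "Suc j"] by simp_all
      then show False
        by (intro fin_case[of "\<lambda>j. p (Suc j)"]) (use p(3,4) alt False in auto)
    qed
  qed
  ultimately show ?thesis unfolding walk_colourable_def by (intro exI[of _ c]) blast
qed

lemma two_power_le_fact: "2 ^ n \<le> (fact (Suc n) :: nat)"
proof (induction n)
  case (Suc n)
  have "(2 :: nat) * 2 ^ n \<le> (Suc (Suc n)) * fact (Suc n)" by (intro mult_mono Suc) auto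
  then show ?case by simp
qed simp

text \<open>
  The summand for \<open>j\<close> is the number of colours for a cut of maximum degree less than $2^{j+1}$, with
  labels over the field with $q = 2^{\lfloor j/d \rfloor + 1}$ elements, so that $q^d \ge 2^{j+1}$.
\<close>

primrec colour_bound :: "nat \<Rightarrow> nat \<Rightarrow> nat" where
  "colour_bound d 0 = 0"
| "colour_bound d (Suc j) = colour_bound d j +
     2 ^ ((j div d + 1) * (d - 1)) * (2 * (3 * ((j div d + 1) * d) + 3))"

text \<open>The crossing edges of a maximum cut form a bipartite graph. The uncut ones have at most
  half of the degree at each vertex, hence less than 2^j in the induction step.\<close>

lemma walk_colourable_bounded_degree:
  assumes k: "k \<ge> 2"
  assumes "finite E" "\<And>e. e \<in> E \<Longrightarrow> card e = 2" "\<And>v. card {e \<in> E. v \<in> e} < 2 ^ j"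
  shows "walk_colourable k E (colour_bound (k + k div 2 - 1) j)"
  using assms(2-)
proof (induction j arbitrary: E)
  case 0
  have "E = {}"
  proof (rule ccontr)
    assume "E \<noteq> {}"
    then obtain e where e: "e \<in> E" by blast
    then obtain v where v: "v \<in> e" using 0(2)[of e] by fastforce
    have "card {e \<in> E. v \<in> e} = 0" using 0(3)[of v] by simp
    then show False using 0(1) e v by auto
  qed
  then show ?case by (simp add: walk_colourable_empty)
next
  case (Suc j)
  define d where "d = k + k div 2 - 1"
  define m where "m = j div d + 1"
  \<comment> \<open>With N = 2^(m d) labels this gives 4 N^3 = 2^(3 m d + 2) <= L!, while L is only
    logarithmic in N.\<close>
  define L where "L = 3 * (m * d) + 3"
  have d: "d \<ge> 2" using k by (auto simp: d_def)
  obtain A where A: "\<And>v. 2 * card {e \<in> E. v \<in> e \<and> \<not> crossing A e} \<le> card {e \<in> E. v \<in> e}"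
    using max_cut[OF Suc.prems(1,2)] by blast
  define E1 where "E1 = {e \<in> E. crossing A e}"
  define E2 where "E2 = {e \<in> E. \<not> crossing A e}"
  have "walk_colourable k E2 (colour_bound d j)"
    unfolding d_def
  proof (rule Suc.IH)
    fix v
    have "card {e \<in> E2. v \<in> e} = card {e \<in> E. v \<in> e \<and> \<not> crossing A e}"
      by (rule arg_cong[of _ _ card]) (auto simp: E2_def)
    then show "card {e \<in> E2. v \<in> e} < 2 ^ j" using A[of v] Suc.prems(3)[of v] by simp
  qed (use Suc.prems in \<open>auto simp: E2_def\<close>)
  moreover have "walk_colourable k E1 (2 ^ (m * (d - 1)) * (2 * L))"
  proof -
    obtain \<kappa> :: "nat \<Rightarrow> nat \<Rightarrow> nat" where \<kappa>: "\<forall>i < (2 ^ m) ^ d. \<forall>j < (2 ^ m) ^ d. \<kappa> i j < (2 ^ m) ^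
        (d - 1)"
     "\<nexists>p c. (\<forall>j. p j < (2 ^ m) ^ d) \<and> (\<forall>j. p (j + 2 * k) = p j) \<and> (\<forall>j. p (j + 2) \<noteq> p j) \<and>
       (\<forall>j. (if even j then \<kappa> (p j) (p (Suc j)) else \<kappa> (p (Suc j)) (p j)) = c)"
      using walk_free_colouring[OF k, of m] unfolding d_def m_def by (auto simp: numeral_2_eq_2)
    have "j < m * d" unfolding m_def using d
      by (metis Suc_eq_plus1 dividend_less_div_times gr0I mult_Suc not_numeral_le_zero)
    then have le: "(2::nat) ^ Suc j \<le> (2 ^ m) ^ d"
      unfolding power_mult[symmetric] by (intro power_increasing) auto
    have "walk_colourable k E1 ((2 ^ m) ^ (d - 1) * (2 * L))"
    proof (rule walk_colourable_bipartite[where A = A and N = "(2 ^ m) ^ d" and \<kappa> = \<kappa>])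
      fix v
      have "card {e \<in> E1. v \<in> e} \<le> card {e \<in> E. v \<in> e}"
        using Suc.prems(1) by (intro card_mono) (auto simp: E1_def)
      then show "card {e \<in> E1. v \<in> e} \<le> (2 ^ m) ^ d" using Suc.prems(3)[of v] le by linarith
    next
      have "4 * ((2 ^ m) ^ d) ^ 3 = (2::nat) ^ (3 * (m * d) + 2)"
        by (simp add: power_add mult.commute flip: power_mult)
      also have "\<dots> \<le> fact L" using two_power_le_fact[of "3 * (m * d) + 2"]
        by (simp add: L_def numeral_3_eq_3)
      finally show "4 * ((2 ^ m) ^ d) ^ 3 \<le> (fact L :: nat)" .
    qed (use Suc.prems \<kappa> in \<open>auto simp: E1_def\<close>)
    then show ?thesis by (simp add: power_mult)
  qed
  ultimately have "walk_colourable k (E2 \<union> E1) (colour_bound d j + 2 ^ (m * (d - 1)) * (2 * L))"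
    by (rule walk_colourable_Un)
  moreover have "E2 \<union> E1 = E" by (auto simp: E1_def E2_def)
  ultimately show ?case by (simp only: colour_bound.simps m_def L_def flip: d_def)
qed

subsection \<open>Degree Ramsey numbers\<close>

text \<open>A monochromatic cycle, traversed periodically, is a closed walk. It never turns back,
  since 2k does not divide 2.\<close>

lemma not_ramsey_arrow_even_cycle:
  fixes H :: "nat ugraph"
  assumes k: "k \<ge> 2" and col: "walk_colourable k (gedges H) s"
  shows "\<not> ramsey_arrow H s (cycle_graph (2 * k))"
proof
  assume arrow: "ramsey_arrow H s (cycle_graph (2 * k))"
  obtain c :: "nat set \<Rightarrow> nat" where c: "c ` gedges H \<subseteq> {..<s}"
    and nowalk: "\<nexists>p i. (\<forall>j. p (j + 2 * k) = p j) \<and> (\<forall>j. p (j + 2) \<noteq> p j) \<and>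
        (\<forall>j. {p j, p (Suc j)} \<in> gedges H \<and> c {p j, p (Suc j)} = i)"
    using col by (auto simp: walk_colourable_def)
  obtain F :: "nat ugraph" and i where F: "is_subgraph F H" "isomorphic_graphs F (cycle_graph
      (2 * k))"
    and mono: "\<forall>e\<in>gedges F. c e = i"
    using arrow c unfolding ramsey_arrow_def by blast
  obtain f where f: "bij_betw f (gverts F) {..<2 * k}"
    "\<And>u v. u \<in> gverts F \<Longrightarrow> v \<in> gverts F \<Longrightarrow>
      {u, v} \<in> gedges F \<longleftrightarrow> {f u, f v} \<in> gedges (cycle_graph (2 * k))"
    using F(2) by (auto simp: isomorphic_graphs_def cycle_graph_def)
  define g where "g = inv_into (gverts F) f"
  have g: "g j \<in> gverts F" "f (g j) = j" if "j < 2 * k" for j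
    using f(1) that bij_betw_inv_into_right[OF f(1)] bij_betwE[OF bij_betw_inv_into[OF f(1)]]
    by (auto simp: g_def)
  define p where "p j = g (j mod (2 * k))" for j
  have p: "p j \<in> gverts F" "f (p j) = j mod (2 * k)" for j
    unfolding p_def by (rule g; use k in simp)+
  have edge: "{p j, p (Suc j)} \<in> gedges F" for j
  proof -
    have "{j mod (2 * k), (j mod (2 * k) + 1) mod (2 * k)} \<in> gedges (cycle_graph (2 * k))"
      using k by (auto simp: cycle_graph_def intro!: exI[of _ "j mod (2 * k)"])
    then show ?thesis using p by (simp add: f(2) mod_Suc_eq)
  qed
  have "p (j + 2) \<noteq> p j" for j
  proof
    assume "p (j + 2) = p j"
    then have "(j + 2) mod (2 * k) = j mod (2 * k)" using p(2) by metis
    then have "2 * k dvd 2" by (metis add_diff_cancel_left' le_add1 mod_eq_dvd_iff_nat)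
    then show False using k by (auto dest: dvd_imp_le)
  qed
  moreover have "p (j + 2 * k) = p j" for j by (simp add: p_def)
  moreover have "{p j, p (Suc j)} \<in> gedges H \<and> c {p j, p (Suc j)} = i" for j
    using edge[of j] mono F(1) by (auto simp: is_subgraph_def)
  ultimately show False using nowalk by blast
qed

text \<open>This makes the infimum in \<open>degree_ramsey\<close> an attained minimum. Ramsey's
  theorem gives a monochromatic clique on m vertices, and it contains the cycle.\<close>

lemma ramsey_arrow_cycle_exists:
  assumes "m \<ge> 3"
  shows "\<exists>H :: nat ugraph. simple_graph H \<and> ramsey_arrow H s (cycle_graph m)"
proof -
  obtain N :: nat where N: "partn_lst {..<N} (replicate s m) 2" using ramsey_full by blast
  define H :: "nat ugraph" where "H = \<lparr>gverts = {..<N}, gedges = nsets {..<N} 2\<rparr>"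
  have "ramsey_arrow H s (cycle_graph m)"
    unfolding ramsey_arrow_def
  proof (intro allI impI)
    fix c :: "nat set \<Rightarrow> nat" assume c: "c ` gedges H \<subseteq> {..<s}"
    then have "c \<in> nsets {..<N} 2 \<rightarrow> {..<length (replicate s m)}" by (auto simp: H_def)
    then obtain i where i: "i < s" "monochromatic {..<N} (replicate s m ! i) 2 c i"
      using N unfolding partn_lst_def by (metis length_replicate)
    then obtain S where S: "S \<in> nsets {..<N} m" "c ` nsets S 2 \<subseteq> {i}"
      by (auto simp: monochromatic_def)
    then have SN: "S \<subseteq> {..<N}" "finite S" "card S = m" by (auto simp: nsets_def)
    then obtain g where g: "bij_betw g {..<m} S"
      by (metis bij_betw_iff_card card_lessThan finite_lessThan)
    have gi: "g x = g y \<longleftrightarrow> x = y" if "x < m" "y < m" for x y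
      using g that by (auto simp: bij_betw_def inj_on_def)
    have gS: "g x \<in> S" if "x < m" for x using g that by (auto simp: bij_betw_def)
    define F where "F = \<lparr>gverts = S, gedges = (\<lambda>e. g ` e) ` gedges (cycle_graph m)\<rparr>"
    have cyc: "\<exists>x y. e = {x, y} \<and> x < m \<and> y < m \<and> x \<noteq> y" if "e \<in> gedges (cycle_graph m)" for e
    proof -
      obtain x where x: "x < m" "e = {x, (x + 1) mod m}" using \<open>e \<in> _\<close>
          by (auto simp: cycle_graph_def)
      have "(x + 1) mod m \<noteq> x" using x assms by (cases "x + 1 = m") auto
      then show ?thesis using x assms by (intro exI[of _ x] exI[of _ "(x + 1) mod m"]) auto
    qed
    have edges: "gedges F \<subseteq> nsets S 2"
    proof
      fix e assume "e \<in> gedges F"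
      then obtain e' where e': "e' \<in> gedges (cycle_graph m)" "e = g ` e'" by (auto simp: F_def)
      then show "e \<in> nsets S 2" using cyc[OF e'(1)] gi gS by auto
    qed
    have "is_subgraph F H"
      using edges SN nsets_mono[OF SN(1), of 2]
      by (auto simp: is_subgraph_def simple_graph_def F_def H_def nsets_def)
    moreover have "isomorphic_graphs F (cycle_graph m)"
      unfolding isomorphic_graphs_def
    proof (intro exI[of _ "inv_into {..<m} g"] conjI ballI)
      show "bij_betw (inv_into {..<m} g) (gverts F) (gverts (cycle_graph m))"
        using bij_betw_inv_into[OF g] by (simp add: F_def cycle_graph_def)
      fix u v assume "u \<in> gverts F" "v \<in> gverts F"
      then obtain x y where xy: "x < m" "y < m" "u = g x" "v = g y"
        using g by (auto simp: F_def bij_betw_def)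
      have inv: "inv_into {..<m} g u = x" "inv_into {..<m} g v = y"
        using xy g by (auto simp: bij_betw_def)
      have "{u, v} = g ` {x, y}" using xy by simp
      have "g ` e = g ` {x, y} \<longleftrightarrow> e = {x, y}" if "e \<in> gedges (cycle_graph m)" for e
      proof -
        have "e \<subseteq> {..<m}" using cyc[OF that] by auto
        moreover have "{x, y} \<subseteq> {..<m}" using xy by auto
        moreover have "inj_on g {..<m}" using g by (auto simp: bij_betw_def)
        ultimately show ?thesis by (metis inj_on_image_eq_iff)
      qed
      moreover have "{u, v} \<in> gedges F \<longleftrightarrow> (\<exists>e\<in>gedges (cycle_graph m). g ` e = g ` {x, y})"
        unfolding \<open>{u, v} = _\<close> by (auto simp: F_def)
      ultimately show "{u, v} \<in> gedges F \<longleftrightarrow>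
          {inv_into {..<m} g u, inv_into {..<m} g v} \<in> gedges (cycle_graph m)"
        unfolding inv by blast
    qed
    moreover have "\<forall>e\<in>gedges F. c e = i" using edges S(2) by auto
    ultimately show "\<exists>F. is_subgraph F H \<and> isomorphic_graphs F (cycle_graph m) \<and>
        (\<exists>i. \<forall>e\<in>gedges F. c e = i)" by blast
  qed
  moreover have "simple_graph H" by (auto simp: simple_graph_def H_def nsets_def)
  ultimately show ?thesis by blast
qed

lemma degree_ramsey_attained:
  assumes "m \<ge> 3"
  obtains H :: "nat ugraph" where "simple_graph H" "ramsey_arrow H s (cycle_graph m)"
    "max_degree H = degree_ramsey (cycle_graph m) s"
proof -
  let ?S = "{max_degree H | H :: nat ugraph. simple_graph H \<and> ramsey_arrow H s (cycle_graph m)}"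
  have "?S \<noteq> {}" using ramsey_arrow_cycle_exists[OF assms, of s] by blast
  then have "Inf ?S \<in> ?S" by (rule Inf_nat_def1)
  then show ?thesis using that unfolding degree_ramsey_def by auto
qed

text \<open>With at least that many colours, the edges of a graph attaining the minimum could be
  coloured without a monochromatic cycle.\<close>

lemma degree_ramsey_even_cycle_colour_bound:
  assumes k: "k \<ge> 2" and \<Delta>: "degree_ramsey (cycle_graph (2 * k)) s < 2 ^ j"
  shows "s < colour_bound (k + k div 2 - 1) j"
proof (rule ccontr)
  assume le: "\<not> s < colour_bound (k + k div 2 - 1) j"
  obtain H :: "nat ugraph" where H: "simple_graph H" "ramsey_arrow H s (cycle_graph (2 * k))"
    "max_degree H = degree_ramsey (cycle_graph (2 * k)) s"
    using degree_ramsey_attained[of "2 * k" s] k by auto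
  have finV: "finite (gverts H)" using H(1) by (simp add: simple_graph_def)
  have "gedges H \<subseteq> Pow (gverts H)" using H(1) by (auto simp: simple_graph_def)
  then have fin: "finite (gedges H)" using finV finite_subset by blast
  have "card {e \<in> gedges H. v \<in> e} < 2 ^ j" for v
  proof (cases "v \<in> gverts H")
    case True
    then have "vertex_degree H v \<le> max_degree H"
      unfolding max_degree_def using finV by (intro Max_ge) auto
    then show ?thesis using \<Delta> H(3) by (simp add: vertex_degree_def)
  next
    case False
    then have "{e \<in> gedges H. v \<in> e} = {}" using H(1) by (auto simp: simple_graph_def)
    then show ?thesis by (simp only: card.empty) simp
  qed
  then have "walk_colourable k (gedges H) (colour_bound (k + k div 2 - 1) j)"
    using H(1) fin by (intro walk_colourable_bounded_degree[OF k]) (auto simp: simple_graph_def)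
  then have "walk_colourable k (gedges H) s" by (rule walk_colourable_mono) (use le in simp)
  then show False using not_ramsey_arrow_even_cycle[OF k] H(2) by blast
qed

section \<open>Asymptotics\<close>

lemma colour_bound_le:
  assumes d: "d \<ge> 2"
  defines "b \<equiv> 2 powr ((real d - 1) / real d)"
  obtains C where "C > 0" "\<And>j. real (colour_bound d j) \<le> C * real j * b ^ j"
proof -
  have b1: "b > 1" using d by (simp add: b_def)
  define C0 where "C0 = 2 ^ d * (3 * real d + 3)"
  \<comment> \<open>The choice solves C0 + C = C b, as the induction over the summands
    requires.\<close>
  define C where "C = C0 / (b - 1)"
  have C0: "C0 > 0" by (simp add: C0_def add_nonneg_pos)
  have C: "C > 0" "C0 + C = C * b" using C0 b1 by (auto simp: C_def field_simps)
  \<comment> \<open>The rounding in the exponent costs at most a factor 2^(d - 1), so each summand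
    is a linear factor times a term of a geometric progression.\<close>
  have step: "real (2 ^ ((j div d + 1) * (d - 1)) * (2 * (3 * ((j div d + 1) * d) + 3)))
      \<le> C0 * (real j + 1) * b ^ j" for j
  proof -
    have "j div d * d \<le> j" by simp
    then have jd: "real (j div d) \<le> real j / real d"
      using d by (simp add: real_of_nat_div le_divide_eq flip: of_nat_mult)
    have "real (2 ^ ((j div d + 1) * (d - 1))) = 2 powr (real (j div d + 1) * real (d - 1))"
      by (simp only: powr_realpow[OF zero_less_numeral] of_nat_power of_nat_numeral flip:
          of_nat_mult)
    also have "\<dots> \<le> 2 powr ((real j / real d + 1) * real (d - 1))"
      using jd by (intro powr_mono mult_right_mono) auto
    also have "(real j / real d + 1) * real (d - 1)
        = real (d - 1) + real j * ((real d - 1) / real d)"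
      using d by (simp add: of_nat_diff field_simps)
    also have "2 powr \<dots> = 2 powr (real (d - 1)) * b ^ j"
      using b1 by (simp add: powr_add b_def powr_powr mult.commute flip: powr_realpow)
    also have "2 powr (real (d - 1)) = 2 ^ (d - 1)" by (simp add: powr_realpow)
    finally have 1: "real (2 ^ ((j div d + 1) * (d - 1))) \<le> 2 ^ (d - 1) * b ^ j" .
    have "(j div d + 1) * d \<le> j + d" by simp
    then have "2 * (3 * ((j div d + 1) * d) + 3) \<le> 2 * (3 * (j + d) + 3)"
      by (intro mult_left_mono add_mono) auto
    also have "\<dots> \<le> 2 * ((3 * d + 3) * (j + 1))" by (simp add: algebra_simps)
    finally have "real (2 * (3 * ((j div d + 1) * d) + 3)) \<le> real (2 * ((3 * d + 3) * (j + 1)))"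
      by (rule of_nat_mono)
    then have 2: "real (2 * (3 * ((j div d + 1) * d) + 3))
        \<le> 2 * ((3 * real d + 3) * (real j + 1))"
      by (simp add: algebra_simps)
    have "real (2 ^ ((j div d + 1) * (d - 1)) * (2 * (3 * ((j div d + 1) * d) + 3)))
      \<le> (2 ^ (d - 1) * b ^ j) * (2 * ((3 * real d + 3) * (real j + 1)))"
      unfolding of_nat_mult[of "2 ^ _"] using 1 2 b1 by (intro mult_mono) auto
    also have "\<dots> = C0 * (real j + 1) * b ^ j"
      using d by (cases d) (auto simp: C0_def)
    finally show ?thesis .
  qed
  have "real (colour_bound d j) \<le> C * real j * b ^ j" for j
  proof (induction j)
    case (Suc j)
    have "real (colour_bound d (Suc j)) \<le> C * real j * b ^ j + C0 * (real j + 1) * b ^ j"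
      unfolding colour_bound.simps of_nat_add by (intro add_mono Suc step)
    also have "\<dots> \<le> (C0 + C) * (real j + 1) * b ^ j"
      using C(1) b1 by (simp add: algebra_simps)
    also have "\<dots> = C * real (Suc j) * b ^ Suc j" unfolding C(2) by (simp add: algebra_simps)
    finally show ?case .
  qed simp
  then show ?thesis using C(1) that by blast
qed

theorem theorem1p3:
  fixes k :: nat and \<delta> :: real
  assumes "k \<ge> 2"
    and "\<delta> = (if odd k then 0 else 1)"
  shows "\<exists>c > (0::real). \<exists>s\<^sub>0 :: nat. \<forall>s \<ge> s\<^sub>0.
           real (degree_ramsey (cycle_graph (2 * k)) s)
             \<ge> c * (real s / ln (real s)) powr (1 + 2 / (3 * real k - 5 + \<delta>))"
proof -
  define d where "d = k + k div 2 - 1"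
  \<comment> \<open>Graphs of degree below 2^j need about 2^(j \<rho>) colours up to a factor j, so
    1/\<rho> = d/(d - 1) is the exponent for the degree. It has the required form because 2(d - 1) =
    3k - 5 + \<delta>.\<close>
  define \<rho> where "\<rho> = (real d - 1) / real d"
  define b where "b = 2 powr \<rho>"
  have d: "d \<ge> 2" using assms(1) by (auto simp: d_def)
  have \<rho>: "\<rho> > 0" using d by (simp add: \<rho>_def)
  have "2 * real d = 3 * real k - 3 + \<delta>"
  proof (cases "even k")
    case True
    then show ?thesis using assms by (auto simp: d_def of_nat_diff elim!: evenE)
  next
    case False
    then show ?thesis using assms by (auto simp: d_def of_nat_diff elim!: oddE)
  qed
  then have "3 * real k - 5 + \<delta> = 2 * (real d - 1)" by simp
  then have ex: "1 + 2 / (3 * real k - 5 + \<delta>) = 1 / \<rho>"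
    using d by (simp add: \<rho>_def field_simps)
  obtain C where C: "C > 0" "\<And>j. real (colour_bound d j) \<le> C * real j * b ^ j"
    using colour_bound_le[OF d] unfolding b_def \<rho>_def by blast
  \<comment> \<open>The maximum covers both cases of the comparison of s with \<open>B\<close>
    below.\<close>
  define C2 where "C2 = max 1 (C / (\<rho> * ln 2))"
  have C2: "C2 \<ge> 1" "C / (\<rho> * ln 2) \<le> C2" by (auto simp: C2_def)
  define c where "c = 1 / (2 * C2 powr (1 / \<rho>))"
  have c: "c > 0" using C2 by (simp add: c_def)
  have "real (degree_ramsey (cycle_graph (2 * k)) s) \<ge> c * (real s / ln (real s)) powr (1 / \<rho>)"
    if s: "s \<ge> 3" for s
  proof -
    define \<Delta> where "\<Delta> = degree_ramsey (cycle_graph (2 * k)) s"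
    have sl: "s < colour_bound d j" if "\<Delta> < 2 ^ j" for j
      using degree_ramsey_even_cycle_colour_bound[OF assms(1)] that unfolding \<Delta>_def d_def by blast
    \<comment> \<open>The colour bound for j = 0 is 0, and no s lies below it.\<close>
    have "\<Delta> \<noteq> 0" using sl[of 0] by auto
    then have ex_j: "\<exists>j. 2 ^ j \<le> \<Delta> \<and> \<Delta> < 2 ^ (j + 1)"
      by (intro ex_power_ivl1) auto
    then obtain i where i: "2 ^ i \<le> \<Delta>" "\<Delta> < 2 ^ (i + 1)" by blast
    define j where "j = i + 1"
    have j: "\<Delta> < 2 ^ j" "2 ^ j \<le> 2 * real \<Delta>" "j \<ge> 1"
      using i of_nat_mono[OF i(1), where 'a = real] by (auto simp: j_def)
    define B where "B = b ^ j"
    have B: "B = 2 powr (real j * \<rho>)"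
      by (simp add: B_def b_def powr_realpow[symmetric] powr_powr mult.commute)
    have B1: "B \<ge> 1" using \<rho> by (simp add: B ge_one_powr_ge_zero)
    \<comment> \<open>The threshold 3 exceeds e, so the logarithm is at least 1.\<close>
    have "exp 1 \<le> real s" using s exp_le by linarith
    then have ln1: "ln (real s) \<ge> 1" using s by (subst ln_ge_iff) auto
    \<comment> \<open>If s <= B, dividing by the logarithm only helps. Otherwise ln s is at least ln
      B = j \<rho> ln 2, and this absorbs the factor j of the colour bound.\<close>
    have "real s / ln (real s) \<le> C2 * B"
    proof (cases "real s \<le> B")
      case True
      have "real s / ln (real s) \<le> real s" using ln1 s by (simp add: divide_le_eq)
      also have "\<dots> \<le> B" by fact
      also have "\<dots> \<le> C2 * B" using C2 B1 by simp
      finally show ?thesis .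
    next
      case False
      have pos: "real j * \<rho> * ln 2 > 0" using j \<rho> by simp
      have "real j * \<rho> * ln 2 = ln B" by (simp add: B ln_powr)
      also have "\<dots> \<le> ln (real s)" using False B1 by simp
      finally have lns: "real j * \<rho> * ln 2 \<le> ln (real s)" .
      have "real s \<le> C * real j * B" using sl[OF j(1)] C(2)[of j] unfolding B_def by linarith
      then have "real s / ln (real s) \<le> (C * real j * B) / (real j * \<rho> * ln 2)"
        using lns pos C(1) B1 by (intro frac_le) auto
      also have "\<dots> = C / (\<rho> * ln 2) * B" using j by simp
      also have "\<dots> \<le> C2 * B" using C2 B1 by (intro mult_right_mono) auto
      finally show ?thesis .
    qed
    then have "(real s / ln (real s)) powr (1 / \<rho>) \<le> (C2 * B) powr (1 / \<rho>)"
      using ln1 \<rho> by (intro powr_mono2) auto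
    also have "\<dots> = C2 powr (1 / \<rho>) * 2 powr real j"
      using C2 B1 \<rho> by (simp add: powr_mult B powr_powr)
    also have "2 powr real j = 2 ^ j" by (simp add: powr_realpow)
    also have "C2 powr (1 / \<rho>) * 2 ^ j \<le> C2 powr (1 / \<rho>) * (2 * real \<Delta>)"
      using j by (intro mult_left_mono) auto
    finally have "(real s / ln (real s)) powr (1 / \<rho>) \<le> C2 powr (1 / \<rho>) * (2 * real \<Delta>)" .
    then show ?thesis using C2 by (simp add: c_def \<Delta>_def field_simps)
  qed
  then show ?thesis using c unfolding ex by blast
qed

end
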